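(* A De Morgan monoid belongs to $\mathsf{U}$ if and only if it is isomorphic to a subdirect product of skew reflections of Dunn monoids, where $\mathit{0}$ is meet-irreducible in each subdirect factor.
   Context: A residuated lattice (RL) is an algebra $\langle B;\cdot,\to,\wedge,\vee,e\rangle$ where $\langle B;\cdot,e\rangle$ is a commutative monoid, $\langle B;\wedge,\vee\rangle$ is a lattice and $x\cdot y\leqslant z$ iff $y\leqslant x\to z$. An involutive residuated lattice (IRL) is an algebra $\langle A;\cdot,\wedge,\vee,\neg,e\rangle$ where $\langle A;\cdot,e\rangle$ is a commutative monoid, $\langle A;\wedge,\vee\rangle$ is a lattice, and $\neg\neg x=x$ and ($x\cdot y\leqslant z$ iff $\neg z\cdot y\leqslant\neg x$); put $f:=\neg e$, $x\to y:=\neg(x\cdot\neg y)$, $x^2:=x\cdot x$. An RL or IRL is square-increasing if $x\leqslant x^2$, and distributive if its lattice reduct is. A De Morgan monoid is a distributive square-increasing IRL; a Dunn monoid is a distributive square-increasing RL. Writing $\mathit{1}:=f^2$ and $q(x):=\mathit{1}\to(\neg x)^2$, $\mathsf{U}$ is the variety of De Morgan monoids satisfying $$x^2\vee(\neg x)^2=\mathit{1},$$ $$\mathit{1}\to(x\vee y)\leqslant(\mathit{1}\to x)\vee(\mathit{1}\to y),$$ $$\mathit{1}\cdot x\cdot y\cdot q(x)\cdot q(y)\leqslant q(x\cdot y)\wedge q(x\vee y)\wedge q(x\to y)\wedge(\mathit{1}\cdot(x\to y)).$$ Skew reflections. Let $B$ be a square-increasing RL with order $\leqslant^B$. Let $B'=\{b':b\in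 B\}$ be a disjoint copy of $B$, let $\mathit{0},\mathit{1}$ be distinct non-elements of $B\cup B'$, and $S=B\cup B'\cup\{\mathit{0},\mathit{1}\}$. Let $\leqslant$ be a lattice order on $S$ whose restriction to $B$ is $\leqslant^B$ and such that for all $b,c\in B$: $b'\leqslant c'$ iff $c\leqslant b$; $b\leqslant c'$ iff $e\leqslant(b\cdot^B c)'$; $b'\not\leqslant c$; $\mathit{0}\leqslant b\leqslant\mathit{1}$ and $\mathit{0}\leqslant b'\leqslant\mathit{1}$. The skew $\leqslant$-reflection $\mathrm{S}^{\leqslant}(B)$ is the algebra $\langle S;\cdot,\wedge,\vee,\neg,e\rangle$, where $\wedge,\vee$ are the lattice operations of $\leqslant$, $\cdot$ is commutative and extends $\cdot^B$, $a\cdot\mathit{0}=\mathit{0}$ for all $a\in S$, $a\cdot\mathit{1}=\mathit{1}$ for all $a\in S\setminus\{\mathit{0}\}$, $b\cdot c'=(b\to^B c)'$ and $b'\cdot c'=\mathit{1}$ for $b,c\in B$, and $\neg\mathit{0}=\mathit{1}$, $\neg\mathit{1}=\mathit{0}$, $\neg b=b'$, $\neg(b')=b$ for $b\in B$. A skew reflection of $B$ is any algebra of this form. (It is always a square-increasing IRL, in which $f^2=\mathit{1}$ and $\neg(f^2)=\mathit{0}$.) The product of the empty family is a trivial algebra. *)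

theory Defs
  imports "HOL-Algebra.Lattice" "HOL-Algebra.Group"
begin

section \<open>Residuated lattices\<close>

text \<open>
  The signature of a commutative monoid (from HOL-Algebra) extended by lattice operations;
  the HOL-Algebra lattices are based on orders rather than on operations.
\<close>

record 'a lat_monoid = "'a monoid" +
  lmeet :: "'a \<Rightarrow> 'a \<Rightarrow> 'a" (infixl "\<curlywedge>\<index>" 68)
  ljoin :: "'a \<Rightarrow> 'a \<Rightarrow> 'a" (infixl "\<curlyvee>\<index>" 66)

record 'a rl = "'a lat_monoid" +
  rimp :: "'a \<Rightarrow> 'a \<Rightarrow> 'a" (infixr "\<rightarrowtriangle>\<index>" 62)

record 'a irl = "'a lat_monoid" +
  neg :: "'a \<Rightarrow> 'a" ("\<sim>\<index> _" [81] 80)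

definition lle :: "('a, 'm) lat_monoid_scheme \<Rightarrow> 'a \<Rightarrow> 'a \<Rightarrow> bool" (infix "\<preceq>\<index>" 50)
  where "x \<preceq>\<^bsub>A\<^esub> y \<longleftrightarrow> x \<curlywedge>\<^bsub>A\<^esub> y = x"

locale lat_monoid = comm_monoid A for A (structure) +
  assumes meet_closed: "\<lbrakk>x \<in> carrier A; y \<in> carrier A\<rbrakk> \<Longrightarrow> x \<curlywedge> y \<in> carrier A"
    and join_closed: "\<lbrakk>x \<in> carrier A; y \<in> carrier A\<rbrakk> \<Longrightarrow> x \<curlyvee> y \<in> carrier A"
    and meet_comm: "\<lbrakk>x \<in> carrier A; y \<in> carrier A\<rbrakk> \<Longrightarrow> x \<curlywedge> y = y \<curlywedge> x"
    and join_comm: "\<lbrakk>x \<in> carrier A; y \<in> carrier A\<rbrakk> \<Longrightarrow> x \<curlyvee> y = y \<curlyvee> x"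
    and meet_assoc: "\<lbrakk>x \<in> carrier A; y \<in> carrier A; z \<in> carrier A\<rbrakk>
      \<Longrightarrow> (x \<curlywedge> y) \<curlywedge> z = x \<curlywedge> (y \<curlywedge> z)"
    and join_assoc: "\<lbrakk>x \<in> carrier A; y \<in> carrier A; z \<in> carrier A\<rbrakk>
      \<Longrightarrow> (x \<curlyvee> y) \<curlyvee> z = x \<curlyvee> (y \<curlyvee> z)"
    and meet_absorb: "\<lbrakk>x \<in> carrier A; y \<in> carrier A\<rbrakk> \<Longrightarrow> x \<curlywedge> (x \<curlyvee> y) = x"
    and join_absorb: "\<lbrakk>x \<in> carrier A; y \<in> carrier A\<rbrakk> \<Longrightarrow> x \<curlyvee> (x \<curlywedge> y) = x"

locale residuated_lattice = lat_monoid A for A (structure) +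
  assumes imp_closed: "\<lbrakk>x \<in> carrier A; y \<in> carrier A\<rbrakk> \<Longrightarrow> x \<rightarrowtriangle> y \<in> carrier A"
    and residuation: "\<lbrakk>x \<in> carrier A; y \<in> carrier A; z \<in> carrier A\<rbrakk>
      \<Longrightarrow> x \<otimes> y \<preceq> z \<longleftrightarrow> y \<preceq> x \<rightarrowtriangle> z"

locale involutive_residuated_lattice = lat_monoid A for A (structure) +
  assumes neg_closed: "x \<in> carrier A \<Longrightarrow> \<sim> x \<in> carrier A"
    and neg_neg: "x \<in> carrier A \<Longrightarrow> \<sim> (\<sim> x) = x"
    and neg_residuation: "\<lbrakk>x \<in> carrier A; y \<in> carrier A; z \<in> carrier A\<rbrakk>
      \<Longrightarrow> x \<otimes> y \<preceq> z \<longleftrightarrow> \<sim> z \<otimes> y \<preceq> \<sim> x"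

locale square_increasing = lat_monoid A for A (structure) +
  assumes square_increasing: "x \<in> carrier A \<Longrightarrow> x \<preceq> x \<otimes> x"

locale distributive_lat = lat_monoid A for A (structure) +
  assumes distrib: "\<lbrakk>x \<in> carrier A; y \<in> carrier A; z \<in> carrier A\<rbrakk>
      \<Longrightarrow> x \<curlywedge> (y \<curlyvee> z) = (x \<curlywedge> y) \<curlyvee> (x \<curlywedge> z)"

locale dunn_monoid = residuated_lattice + square_increasing + distributive_lat

locale de_morgan_monoid = involutive_residuated_lattice + square_increasing + distributive_lat

section \<open>The variety U\<close>

definition irl_imp :: "('a, 'm) irl_scheme \<Rightarrow> 'a \<Rightarrow> 'a \<Rightarrow> 'a" (infixr "\<leadsto>\<index>" 62)
  where "x \<leadsto>\<^bsub>A\<^esub> y = \<sim>\<^bsub>A\<^esub> (x \<otimes>\<^bsub>A\<^esub> \<sim>\<^bsub>A\<^esub> y)"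

text \<open>The element f squared, where f is the negation of the monoid identity (the paper's 1).\<close>

definition f_sq :: "('a, 'm) irl_scheme \<Rightarrow> 'a" ("\<bbbone>\<index>")
  where "\<bbbone>\<^bsub>A\<^esub> = \<sim>\<^bsub>A\<^esub> \<one>\<^bsub>A\<^esub> \<otimes>\<^bsub>A\<^esub> \<sim>\<^bsub>A\<^esub> \<one>\<^bsub>A\<^esub>"

definition q_term :: "('a, 'm) irl_scheme \<Rightarrow> 'a \<Rightarrow> 'a"
  where "q_term A x = \<bbbone>\<^bsub>A\<^esub> \<leadsto>\<^bsub>A\<^esub> (\<sim>\<^bsub>A\<^esub> x \<otimes>\<^bsub>A\<^esub> \<sim>\<^bsub>A\<^esub> x)"

locale variety_U = de_morgan_monoid A for A (structure) +
  assumes U_square: "x \<in> carrier A \<Longrightarrow> (x \<otimes> x) \<curlyvee> (\<sim> x \<otimes> \<sim> x) = \<bbbone>"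
    and U_join: "\<lbrakk>x \<in> carrier A; y \<in> carrier A\<rbrakk>
      \<Longrightarrow> \<bbbone> \<leadsto> (x \<curlyvee> y) \<preceq> (\<bbbone> \<leadsto> x) \<curlyvee> (\<bbbone> \<leadsto> y)"
    and U_q: "\<lbrakk>x \<in> carrier A; y \<in> carrier A\<rbrakk>
      \<Longrightarrow> \<bbbone> \<otimes> x \<otimes> y \<otimes> q_term A x \<otimes> q_term A y
          \<preceq> q_term A (x \<otimes> y) \<curlywedge> q_term A (x \<curlyvee> y) \<curlywedge>
             q_term A (x \<leadsto> y) \<curlywedge> (\<bbbone> \<otimes> (x \<leadsto> y))"

section \<open>Skew reflections\<close>

text \<open>\<open>Base b\<close> is the element b itself and \<open>Copy b\<close> its primed copy.\<close>

datatype 'b skew = Base 'b | Copy 'b | Zero | One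

definition skew_carrier :: "('b, 'm) rl_scheme \<Rightarrow> 'b skew set"
  where "skew_carrier B = Base ` carrier B \<union> Copy ` carrier B \<union> {Zero, One}"

abbreviation skew_gorder :: "('b, 'm) rl_scheme \<Rightarrow> ('b skew \<Rightarrow> 'b skew \<Rightarrow> bool) \<Rightarrow> 'b skew gorder"
  where "skew_gorder B leq \<equiv> \<lparr>carrier = skew_carrier B, eq = (=), le = leq\<rparr>"

definition skew_order :: "('b, 'm) rl_scheme \<Rightarrow> ('b skew \<Rightarrow> 'b skew \<Rightarrow> bool) \<Rightarrow> bool"
  where "skew_order B leq \<longleftrightarrow>
    Lattice.lattice (skew_gorder B leq) \<and>
    (\<forall>b \<in> carrier B. \<forall>c \<in> carrier B.
      (leq (Base b) (Base c) \<longleftrightarrow> b \<preceq>\<^bsub>B\<^esub> c) \<and>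
      (leq (Copy b) (Copy c) \<longleftrightarrow> c \<preceq>\<^bsub>B\<^esub> b) \<and>
      (leq (Base b) (Copy c) \<longleftrightarrow> leq (Base \<one>\<^bsub>B\<^esub>) (Copy (b \<otimes>\<^bsub>B\<^esub> c))) \<and>
      \<not> leq (Copy b) (Base c)) \<and>
    (\<forall>b \<in> carrier B.
      leq Zero (Base b) \<and> leq (Base b) One \<and> leq Zero (Copy b) \<and> leq (Copy b) One)"

fun skew_mult :: "('b, 'm) rl_scheme \<Rightarrow> 'b skew \<Rightarrow> 'b skew \<Rightarrow> 'b skew"
  where
    "skew_mult B Zero y = Zero"
  | "skew_mult B x Zero = Zero"
  | "skew_mult B One y = One"
  | "skew_mult B x One = One"
  | "skew_mult B (Base b) (Base c) = Base (b \<otimes>\<^bsub>B\<^esub> c)"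
  | "skew_mult B (Base b) (Copy c) = Copy (b \<rightarrowtriangle>\<^bsub>B\<^esub> c)"
  | "skew_mult B (Copy b) (Base c) = Copy (c \<rightarrowtriangle>\<^bsub>B\<^esub> b)"
  | "skew_mult B (Copy b) (Copy c) = One"

fun skew_neg :: "'b skew \<Rightarrow> 'b skew"
  where
    "skew_neg Zero = One"
  | "skew_neg One = Zero"
  | "skew_neg (Base b) = Copy b"
  | "skew_neg (Copy b) = Base b"

definition skew_reflection ::
    "('b, 'm) rl_scheme \<Rightarrow> ('b skew \<Rightarrow> 'b skew \<Rightarrow> bool) \<Rightarrow> 'b skew irl"
  where "skew_reflection B leq =
    \<lparr>carrier = skew_carrier B,
     monoid.mult = skew_mult B,
     one = Base \<one>\<^bsub>B\<^esub>,
     lmeet = Lattice.meet (skew_gorder B leq),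
     ljoin = Lattice.join (skew_gorder B leq),
     neg = skew_neg\<rparr>"

definition is_skew_reflection :: "('b, 'm) rl_scheme \<Rightarrow> 'b skew irl \<Rightarrow> bool"
  where "is_skew_reflection B S \<longleftrightarrow>
    residuated_lattice B \<and> square_increasing B \<and>
    (\<exists>leq. skew_order B leq \<and> S = skew_reflection B leq)"

definition meet_irreducible :: "('a, 'm) lat_monoid_scheme \<Rightarrow> 'a \<Rightarrow> bool"
  where "meet_irreducible A z \<longleftrightarrow> z \<in> carrier A \<and>
    (\<forall>x \<in> carrier A. \<forall>y \<in> carrier A. x \<curlywedge>\<^bsub>A\<^esub> y = z \<longrightarrow> x = z \<or> y = z)"

section \<open>Subdirect products\<close>

definition irl_iso :: "'a irl \<Rightarrow> 'b irl \<Rightarrow> ('a \<Rightarrow> 'b) set"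
  where "irl_iso A B =
    {h. bij_betw h (carrier A) (carrier B) \<and>
        h \<one>\<^bsub>A\<^esub> = \<one>\<^bsub>B\<^esub> \<and>
        (\<forall>x \<in> carrier A. h (\<sim>\<^bsub>A\<^esub> x) = \<sim>\<^bsub>B\<^esub> (h x)) \<and>
        (\<forall>x \<in> carrier A. \<forall>y \<in> carrier A.
          h (x \<otimes>\<^bsub>A\<^esub> y) = h x \<otimes>\<^bsub>B\<^esub> h y \<and>
          h (x \<curlywedge>\<^bsub>A\<^esub> y) = h x \<curlywedge>\<^bsub>B\<^esub> h y \<and>
          h (x \<curlyvee>\<^bsub>A\<^esub> y) = h x \<curlyvee>\<^bsub>B\<^esub> h y)}"

text \<open>For \<open>I = {}\<close> the carrier is a singleton.\<close>

definition irl_prod :: "'i set \<Rightarrow> ('i \<Rightarrow> 'b irl) \<Rightarrow> ('i \<Rightarrow> 'b) irl"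
  where "irl_prod I F =
    \<lparr>carrier = (\<Pi>\<^sub>E i\<in>I. carrier (F i)),
     monoid.mult = (\<lambda>x y. \<lambda>i\<in>I. x i \<otimes>\<^bsub>F i\<^esub> y i),
     one = (\<lambda>i\<in>I. \<one>\<^bsub>F i\<^esub>),
     lmeet = (\<lambda>x y. \<lambda>i\<in>I. x i \<curlywedge>\<^bsub>F i\<^esub> y i),
     ljoin = (\<lambda>x y. \<lambda>i\<in>I. x i \<curlyvee>\<^bsub>F i\<^esub> y i),
     neg = (\<lambda>x. \<lambda>i\<in>I. \<sim>\<^bsub>F i\<^esub> (x i))\<rparr>"

definition irl_subuniverse :: "'a set \<Rightarrow> 'a irl \<Rightarrow> bool"
  where "irl_subuniverse X A \<longleftrightarrow>
    X \<subseteq> carrier A \<and> \<one>\<^bsub>A\<^esub> \<in> X \<and>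
    (\<forall>x \<in> X. \<sim>\<^bsub>A\<^esub> x \<in> X) \<and>
    (\<forall>x \<in> X. \<forall>y \<in> X. x \<otimes>\<^bsub>A\<^esub> y \<in> X \<and> x \<curlywedge>\<^bsub>A\<^esub> y \<in> X \<and> x \<curlyvee>\<^bsub>A\<^esub> y \<in> X)"

definition subdirect_product :: "'i set \<Rightarrow> ('i \<Rightarrow> 'b irl) \<Rightarrow> ('i \<Rightarrow> 'b) irl \<Rightarrow> bool"
  where "subdirect_product I F P \<longleftrightarrow>
    (\<exists>X. irl_subuniverse X (irl_prod I F) \<and> P = (irl_prod I F)\<lparr>carrier := X\<rparr> \<and>
         (\<forall>i \<in> I. (\<lambda>x. x i) ` X = carrier (F i)))"

text \<open>
  Types cannot be quantified in HOL, so the index set and the Dunn monoids are drawn from type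
  parameters \<open>'i\<close> and \<open>'b\<close>. If \<open>A\<close> has a representation at all, then it has one in which \<open>'i\<close> is
  \<open>'a \<times> 'a\<close> (separating pairs) and \<open>'b\<close> is \<open>'a\<close> (each factor is a quotient of \<open>A\<close>).
\<close>

definition skew_subdirect_representation ::
    "'a irl \<Rightarrow> 'i set \<Rightarrow> ('i \<Rightarrow> 'b rl) \<Rightarrow> ('i \<Rightarrow> 'b skew irl) \<Rightarrow> bool"
  where "skew_subdirect_representation A I B F \<longleftrightarrow>
    (\<forall>i \<in> I. dunn_monoid (B i) \<and> is_skew_reflection (B i) (F i) \<and> meet_irreducible (F i) Zero) \<and>
    (\<exists>P. subdirect_product I F P \<and> irl_iso A P \<noteq> {})"

end

theory Submission
  imports Defs
begin

text \<open>
  In a skew reflection with 0 meet-irreducible, 1 is join-irreducible, \<open>1 \<rightarrow> x\<close> is 1 or 0 according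
  to whether \<open>x = 1\<close>, and \<open>q(x) = 1\<close> holds exactly for \<open>x\<close> in B or \<open>x = 0\<close>. With this the
  defining identities of U can be read off, and they pass to subdirect products.

  Conversely, square-increasingness makes every lattice filter containing \<open>e\<close> deductive, so for
  \<open>\<not> x \<le> y\<close> a prime filter containing \<open>e\<close> but not \<open>x \<rightarrow> y\<close> gives a quotient that separates
  \<open>x\<close> and \<open>y\<close> and in which \<open>e\<close> is join-prime. In such a quotient 1 is the top,
  \<open>1 \<cdot> x = 1\<close> for \<open>x \<noteq> 0\<close>, and 1 is join-irreducible. The first identity then says that every
  \<open>x\<close> has \<open>x\<^sup>2 = 1\<close> or \<open>(\<not>x)\<^sup>2 = 1\<close>, and the third that the elements \<open>x \<noteq> 0\<close> with
  \<open>(\<not>x)\<^sup>2 = 1\<close> are closed under the Dunn monoid operations. Their negations form the disjoint copy,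
  and the quotient is a skew reflection of this Dunn monoid.
\<close>

section \<open>Involutive residuated lattices\<close>

context lat_monoid
begin

lemma meet_idem: "x \<in> carrier A \<Longrightarrow> x \<curlywedge> x = x"
  by (metis join_closed join_absorb meet_absorb)

lemma le_refl [simp]: "x \<in> carrier A \<Longrightarrow> x \<preceq> x"
  by (simp add: lle_def meet_idem)

lemma le_antisym: "\<lbrakk>x \<preceq> y; y \<preceq> x; x \<in> carrier A; y \<in> carrier A\<rbrakk> \<Longrightarrow> x = y"
  by (metis lle_def meet_comm)

lemma le_trans: "\<lbrakk>x \<preceq> y; y \<preceq> z; x \<in> carrier A; y \<in> carrier A; z \<in> carrier A\<rbrakk> \<Longrightarrow> x \<preceq> z"
  by (metis lle_def meet_assoc)

lemma meet_le1: "\<lbrakk>x \<in> carrier A; y \<in> carrier A\<rbrakk> \<Longrightarrow> x \<curlywedge> y \<preceq> x"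
  unfolding lle_def by (metis meet_assoc meet_comm meet_idem meet_closed)

lemma meet_le2: "\<lbrakk>x \<in> carrier A; y \<in> carrier A\<rbrakk> \<Longrightarrow> x \<curlywedge> y \<preceq> y"
  by (metis meet_comm meet_le1)

lemma le_meetI:
  "\<lbrakk>z \<preceq> x; z \<preceq> y; x \<in> carrier A; y \<in> carrier A; z \<in> carrier A\<rbrakk> \<Longrightarrow> z \<preceq> x \<curlywedge> y"
  unfolding lle_def by (metis meet_assoc)

lemma meet_mono:
  assumes "x \<preceq> y" "z \<preceq> w" "x \<in> carrier A" "y \<in> carrier A" "z \<in> carrier A" "w \<in> carrier A"
  shows "x \<curlywedge> z \<preceq> y \<curlywedge> w"
  using assms by (intro le_meetI) (meson le_trans meet_le1 meet_le2 meet_closed)+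

lemma le_iff_join: "\<lbrakk>x \<in> carrier A; y \<in> carrier A\<rbrakk> \<Longrightarrow> x \<preceq> y \<longleftrightarrow> x \<curlyvee> y = y"
  unfolding lle_def by (metis join_absorb meet_absorb join_comm meet_comm)

lemma le_join1: "\<lbrakk>x \<in> carrier A; y \<in> carrier A\<rbrakk> \<Longrightarrow> x \<preceq> x \<curlyvee> y"
  by (simp add: lle_def meet_absorb)

lemma le_join2: "\<lbrakk>x \<in> carrier A; y \<in> carrier A\<rbrakk> \<Longrightarrow> y \<preceq> x \<curlyvee> y"
  by (metis join_comm le_join1)

lemma join_leI:
  "\<lbrakk>x \<preceq> z; y \<preceq> z; x \<in> carrier A; y \<in> carrier A; z \<in> carrier A\<rbrakk> \<Longrightarrow> x \<curlyvee> y \<preceq> z"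
  by (metis le_iff_join join_assoc join_closed)

end

section \<open>Residuation and involution\<close>

context involutive_residuated_lattice
begin

lemma irl_imp_closed: "\<lbrakk>x \<in> carrier A; y \<in> carrier A\<rbrakk> \<Longrightarrow> x \<leadsto> y \<in> carrier A"
  by (simp add: irl_imp_def neg_closed)

lemma f_sq_closed: "\<bbbone> \<in> carrier A"
  by (simp add: f_sq_def neg_closed)

lemma q_term_closed: "x \<in> carrier A \<Longrightarrow> q_term A x \<in> carrier A"
  by (simp add: q_term_def irl_imp_closed f_sq_closed neg_closed)

lemmas closed = irl_imp_closed f_sq_closed q_term_closed neg_closed meet_closed join_closed

lemma neg_eq_iff: "\<lbrakk>x \<in> carrier A; y \<in> carrier A\<rbrakk> \<Longrightarrow> \<sim> x = y \<longleftrightarrow> x = \<sim> y"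
  using neg_neg by metis

lemma le_neg_iff: "\<lbrakk>x \<in> carrier A; y \<in> carrier A\<rbrakk> \<Longrightarrow> \<sim> y \<preceq> \<sim> x \<longleftrightarrow> x \<preceq> y"
  using neg_residuation[of x \<one> y] by (simp add: closed)

lemma le_neg_swap: "\<lbrakk>x \<in> carrier A; y \<in> carrier A\<rbrakk> \<Longrightarrow> x \<preceq> \<sim> y \<longleftrightarrow> y \<preceq> \<sim> x"
  using le_neg_iff[of x "\<sim> y"] by (simp add: closed neg_neg)

text \<open>The axiom \<open>neg_residuation\<close>, with the two factors interchanged, yields
  \<open>\<sim> z \<otimes> x \<preceq> \<sim> y\<close>. Contraposition turns this into
  \<open>y \<preceq> \<sim> (x \<otimes> \<sim> z)\<close>, whose right side is the implication by
  definition.\<close>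

lemma residuation:
  assumes "x \<in> carrier A" "y \<in> carrier A" "z \<in> carrier A"
  shows "x \<otimes> y \<preceq> z \<longleftrightarrow> y \<preceq> x \<leadsto> z"
  using assms neg_residuation[of y x z] le_neg_swap[of y "x \<otimes> \<sim> z"]
  by (simp add: closed irl_imp_def m_comm)

lemma mult_imp_le: "\<lbrakk>x \<in> carrier A; y \<in> carrier A\<rbrakk> \<Longrightarrow> x \<otimes> (x \<leadsto> y) \<preceq> y"
  by (simp add: residuation closed)

lemma mult_mono_right:
  assumes "y \<preceq> z" "x \<in> carrier A" "y \<in> carrier A" "z \<in> carrier A"
  shows "x \<otimes> y \<preceq> x \<otimes> z"
proof -
  have "z \<preceq> x \<leadsto> (x \<otimes> z)" using assms residuation[of x z "x \<otimes> z"] by simp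
  then show ?thesis using assms by (simp add: residuation closed) (meson assms closed le_trans m_closed)
qed

lemma mult_mono:
  assumes "x \<preceq> y" "z \<preceq> w" "x \<in> carrier A" "y \<in> carrier A" "z \<in> carrier A" "w \<in> carrier A"
  shows "x \<otimes> z \<preceq> y \<otimes> w"
proof (rule le_trans)
  show "x \<otimes> z \<preceq> x \<otimes> w" using assms by (simp add: mult_mono_right)
  show "x \<otimes> w \<preceq> y \<otimes> w" using assms mult_mono_right[of x y w] by (simp add: m_comm)
qed (use assms in auto)

lemma neg_join:
  assumes "x \<in> carrier A" "y \<in> carrier A"
  shows "\<sim> (x \<curlyvee> y) = \<sim> x \<curlywedge> \<sim> y"
proof (rule le_antisym)
  show "\<sim> (x \<curlyvee> y) \<preceq> \<sim> x \<curlywedge> \<sim> y"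
    using assms by (intro le_meetI) (auto simp: closed le_neg_iff le_join1 le_join2)
  have "x \<curlyvee> y \<preceq> \<sim> (\<sim> x \<curlywedge> \<sim> y)"
    using assms le_neg_swap meet_le1[of "\<sim> x" "\<sim> y"] meet_le2[of "\<sim> x" "\<sim> y"]
    by (intro join_leI) (auto simp: closed)
  then show "\<sim> x \<curlywedge> \<sim> y \<preceq> \<sim> (x \<curlyvee> y)"
    using assms le_neg_swap by (simp add: closed)
qed (use assms in \<open>auto simp: closed\<close>)

lemma imp_contrapos:
  assumes "x \<in> carrier A" "y \<in> carrier A"
  shows "\<sim> y \<leadsto> \<sim> x = x \<leadsto> y"
  using assms by (simp add: irl_imp_def neg_neg closed m_comm)

lemma one_imp: "x \<in> carrier A \<Longrightarrow> \<one> \<leadsto> x = x"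
  by (simp add: irl_imp_def neg_neg closed)

lemma le_iff_one_le_imp: "\<lbrakk>x \<in> carrier A; y \<in> carrier A\<rbrakk> \<Longrightarrow> x \<preceq> y \<longleftrightarrow> \<one> \<preceq> x \<leadsto> y"
  using residuation[of x \<one> y] by simp

text \<open>This inequality and the three after it place an implication above another one, or above
  a product or meet of two. Deductive filters thereby inherit transitivity and compatibility with
  all operations.\<close>

lemma imp_trans:
  assumes "x \<in> carrier A" "y \<in> carrier A" "z \<in> carrier A"
  shows "(x \<leadsto> y) \<otimes> (y \<leadsto> z) \<preceq> x \<leadsto> z"
proof -
  have "x \<otimes> ((x \<leadsto> y) \<otimes> (y \<leadsto> z)) \<preceq> y \<otimes> (y \<leadsto> z)"
    using assms mult_mono[OF mult_imp_le[of x y] le_refl[of "y \<leadsto> z"]]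
    by (simp add: closed m_assoc)
  then have "x \<otimes> ((x \<leadsto> y) \<otimes> (y \<leadsto> z)) \<preceq> z"
    using le_trans[OF _ mult_imp_le[of y z]] assms by (simp add: closed)
  then show ?thesis using assms by (simp add: residuation closed)
qed

lemma imp_mult:
  assumes "x \<in> carrier A" "y \<in> carrier A" "z \<in> carrier A"
  shows "x \<leadsto> y \<preceq> (z \<otimes> x) \<leadsto> (z \<otimes> y)"
proof -
  have "z \<otimes> x \<otimes> (x \<leadsto> y) \<preceq> z \<otimes> y"
    using assms by (simp add: m_assoc closed mult_mono mult_imp_le)
  then show ?thesis using assms by (simp add: residuation closed)
qed

lemma imp_meet:
  assumes "x \<in> carrier A" "y \<in> carrier A" "z \<in> carrier A"
  shows "(z \<leadsto> x) \<curlywedge> (z \<leadsto> y) \<preceq> z \<leadsto> (x \<curlywedge> y)"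
proof -
  let ?w = "(z \<leadsto> x) \<curlywedge> (z \<leadsto> y)"
  have "z \<otimes> ?w \<preceq> x" "z \<otimes> ?w \<preceq> y"
    using assms by (simp_all add: residuation closed meet_le1 meet_le2)
  then have "z \<otimes> ?w \<preceq> x \<curlywedge> y"
    using assms by (intro le_meetI) (auto simp: closed)
  then show ?thesis using assms by (simp add: residuation closed)
qed

text \<open>Contraposition reduces this to \<open>imp_meet\<close>, because negation turns joins
  into meets.\<close>

lemma imp_join:
  assumes "x \<in> carrier A" "y \<in> carrier A" "z \<in> carrier A"
  shows "(x \<leadsto> z) \<curlywedge> (y \<leadsto> z) \<preceq> (x \<curlyvee> y) \<leadsto> z"
  using assms imp_meet[of "\<sim> x" "\<sim> y" "\<sim> z"]
    imp_contrapos[of x z] imp_contrapos[of y z] imp_contrapos[of "x \<curlyvee> y" z]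
  by (simp add: closed neg_join)

end

text \<open>HOL-Algebra chooses meets and joins as bounds of an order, so they have to be identified
  here: a preimage of \<open>g s \<curlywedge> g t\<close> is a greatest lower bound for the order
  pulled back along \<open>g\<close>, and such bounds are unique; dually for joins.\<close>

lemma (in lat_monoid) transported_lattice:
  assumes bij: "bij_betw g C (carrier A)"
  defines "L \<equiv> \<lparr>carrier = C, eq = (=), le = (\<lambda>s t. g s \<preceq> g t)\<rparr>"
  shows "Lattice.lattice L"
    and "\<lbrakk>s \<in> C; t \<in> C\<rbrakk> \<Longrightarrow> g (Lattice.meet L s t) = g s \<curlywedge> g t"
    and "\<lbrakk>s \<in> C; t \<in> C\<rbrakk> \<Longrightarrow> g (Lattice.join L s t) = g s \<curlyvee> g t"
proof -
  have g_closed: "g s \<in> carrier A" if "s \<in> C" for s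
    using bij that by (auto simp: bij_betw_def)
  have preimage: "\<exists>s \<in> C. g s = x" if "x \<in> carrier A" for x
    using bij that unfolding bij_betw_def by (metis imageE)
  have "s = t" if "g s \<preceq> g t" "g t \<preceq> g s" "s \<in> C" "t \<in> C" for s t
    using bij that le_antisym g_closed by (auto simp: bij_betw_def inj_on_def)
  moreover have "g s \<preceq> g u" if "g s \<preceq> g t" "g t \<preceq> g u" "s \<in> C" "t \<in> C" "u \<in> C" for s t u
    using that le_trans g_closed by blast
  ultimately interpret partial_order L
    by unfold_locales (auto simp: L_def g_closed)
  have greatest: "greatest L m (Lower L {s, t})" if "s \<in> C" "t \<in> C" "m \<in> C" "g m = g s \<curlywedge> g t" for s t m
    using that by (auto simp: greatest_def Lower_def L_def g_closed meet_le1 meet_le2 le_meetI)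
  have least: "least L m (Upper L {s, t})" if "s \<in> C" "t \<in> C" "m \<in> C" "g m = g s \<curlyvee> g t" for s t m
    using that by (auto simp: least_def Upper_def L_def g_closed le_join1 le_join2 join_leI)
  have meet: "\<exists>m \<in> C. g m = g s \<curlywedge> g t \<and> greatest L m (Lower L {s, t})"
    and join: "\<exists>m \<in> C. g m = g s \<curlyvee> g t \<and> least L m (Upper L {s, t})"
    if "s \<in> C" "t \<in> C" for s t
    using preimage[of "g s \<curlywedge> g t"] preimage[of "g s \<curlyvee> g t"] that greatest least
    by (auto simp: g_closed meet_closed join_closed)
  have "carrier L = C" by (simp add: L_def)
  then show lattice: "Lattice.lattice L"
    using meet join by unfold_locales blast+
  interpret Lattice.lattice L by (fact lattice)
  show "g (Lattice.meet L s t) = g s \<curlywedge> g t" if "s \<in> C" "t \<in> C"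
    using meet[OF that] inf_of_two_greatest[of s t] greatest_unique that \<open>carrier L = C\<close>
    by (auto simp: Lattice.meet_def)
  show "g (Lattice.join L s t) = g s \<curlyvee> g t" if "s \<in> C" "t \<in> C"
    using join[OF that] sup_of_two_least[of s t] least_unique that \<open>carrier L = C\<close>
    by (auto simp: Lattice.join_def)
qed

section \<open>Homomorphisms\<close>

text \<open>The conditions of \<open>irl_iso\<close> with bijectivity weakened to membership in the
  codomain, since quotient maps and coordinate projections need not be injective.\<close>

definition irl_hom :: "'a irl \<Rightarrow> 'b irl \<Rightarrow> ('a \<Rightarrow> 'b) set"
  where "irl_hom A B =
    {h \<in> carrier A \<rightarrow> carrier B. h \<one>\<^bsub>A\<^esub> = \<one>\<^bsub>B\<^esub> \<and>
        (\<forall>x \<in> carrier A. h (\<sim>\<^bsub>A\<^esub> x) = \<sim>\<^bsub>B\<^esub> (h x)) \<and>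
        (\<forall>x \<in> carrier A. \<forall>y \<in> carrier A.
          h (x \<otimes>\<^bsub>A\<^esub> y) = h x \<otimes>\<^bsub>B\<^esub> h y \<and>
          h (x \<curlywedge>\<^bsub>A\<^esub> y) = h x \<curlywedge>\<^bsub>B\<^esub> h y \<and>
          h (x \<curlyvee>\<^bsub>A\<^esub> y) = h x \<curlyvee>\<^bsub>B\<^esub> h y)}"

lemma irl_hom_compose:
  assumes "h \<in> irl_hom A B" "k \<in> irl_hom B C"
  shows "k \<circ> h \<in> irl_hom A C"
  using assms by (auto simp: irl_hom_def Pi_iff)

locale irl_homomorphism = involutive_residuated_lattice A
  for A :: "'a irl" (structure) and B :: "'b irl" and h +
  assumes hom: "h \<in> irl_hom A B"
begin

lemma hom_closed: "x \<in> carrier A \<Longrightarrow> h x \<in> carrier B"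
  and hom_one: "h \<one> = \<one>\<^bsub>B\<^esub>"
  and hom_neg: "x \<in> carrier A \<Longrightarrow> h (\<sim> x) = \<sim>\<^bsub>B\<^esub> (h x)"
  and hom_mult: "\<lbrakk>x \<in> carrier A; y \<in> carrier A\<rbrakk> \<Longrightarrow> h (x \<otimes> y) = h x \<otimes>\<^bsub>B\<^esub> h y"
  and hom_meet: "\<lbrakk>x \<in> carrier A; y \<in> carrier A\<rbrakk> \<Longrightarrow> h (x \<curlywedge> y) = h x \<curlywedge>\<^bsub>B\<^esub> h y"
  and hom_join: "\<lbrakk>x \<in> carrier A; y \<in> carrier A\<rbrakk> \<Longrightarrow> h (x \<curlyvee> y) = h x \<curlyvee>\<^bsub>B\<^esub> h y"
  using hom unfolding irl_hom_def by auto

lemma hom_imp: "\<lbrakk>x \<in> carrier A; y \<in> carrier A\<rbrakk> \<Longrightarrow> h (x \<leadsto> y) = h x \<leadsto>\<^bsub>B\<^esub> h y"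
  by (simp add: irl_imp_def hom_neg hom_mult closed)

lemma hom_f_sq: "h \<bbbone> = \<bbbone>\<^bsub>B\<^esub>"
  by (simp add: f_sq_def hom_neg hom_mult hom_one closed)

lemma hom_q_term: "x \<in> carrier A \<Longrightarrow> h (q_term A x) = q_term B (h x)"
  by (simp add: q_term_def hom_imp hom_f_sq hom_neg hom_mult closed)

lemmas hom_simps = hom_closed hom_one hom_neg hom_mult hom_meet hom_join hom_imp hom_f_sq hom_q_term

lemma hom_le: "\<lbrakk>x \<preceq> y; x \<in> carrier A; y \<in> carrier A\<rbrakk> \<Longrightarrow> h x \<preceq>\<^bsub>B\<^esub> h y"
  unfolding lle_def using hom_meet by fastforce

end

text \<open>Surjectivity lets every argument be pulled back to \<open>A\<close>; the homomorphism
  preserves terms and, through meets, the order.\<close>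

lemma variety_U_image:
  assumes "variety_U A" "h \<in> irl_hom A Q" "h ` carrier A = carrier Q" "de_morgan_monoid Q"
  shows "variety_U Q"
proof -
  interpret A: variety_U A by fact
  interpret Q: de_morgan_monoid Q by fact
  interpret irl_homomorphism A Q h by unfold_locales fact
  show ?thesis
  proof (unfold_locales, goal_cases)
    case (1 x)
    then obtain a where a: "a \<in> carrier A" "x = h a" using assms(3) by blast
    show ?case using arg_cong[OF A.U_square[OF a(1)], of h] a by (simp add: A.closed hom_simps)
  next
    case (2 x y)
    then obtain a b where ab: "a \<in> carrier A" "x = h a" "b \<in> carrier A" "y = h b"
      using assms(3) by blast
    show ?case using hom_le[OF A.U_join[OF ab(1,3)]] ab by (simp add: A.closed hom_simps)
  next
    case (3 x y)
    then obtain a b where ab: "a \<in> carrier A" "x = h a" "b \<in> carrier A" "y = h b"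
      using assms(3) by blast
    show ?case using hom_le[OF A.U_q[OF ab(1,3)]] ab by (simp add: A.closed hom_simps)
  qed
qed

section \<open>Deductive filters and quotients\<close>

text \<open>Classes modulo a filter are replaced by chosen representatives, so that quotients of an
  algebra on \<open>'a\<close> again live on \<open>'a\<close>.\<close>

definition filter_rep :: "'a irl \<Rightarrow> 'a set \<Rightarrow> 'a \<Rightarrow> 'a"
  where "filter_rep A F x =
    (SOME y. y \<in> carrier A \<and> x \<leadsto>\<^bsub>A\<^esub> y \<in> F \<and> y \<leadsto>\<^bsub>A\<^esub> x \<in> F)"

definition irl_quotient :: "'a irl \<Rightarrow> 'a set \<Rightarrow> 'a irl"
  where "irl_quotient A F =
    \<lparr>carrier = filter_rep A F ` carrier A,
     monoid.mult = (\<lambda>x y. filter_rep A F (x \<otimes>\<^bsub>A\<^esub> y)),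
     one = filter_rep A F \<one>\<^bsub>A\<^esub>,
     lmeet = (\<lambda>x y. filter_rep A F (x \<curlywedge>\<^bsub>A\<^esub> y)),
     ljoin = (\<lambda>x y. filter_rep A F (x \<curlyvee>\<^bsub>A\<^esub> y)),
     neg = (\<lambda>x. filter_rep A F (\<sim>\<^bsub>A\<^esub> x))\<rparr>"

locale deductive_filter = de_morgan_monoid A for A :: "'a irl" (structure) and F +
  assumes filter_subset: "F \<subseteq> carrier A"
    and filter_one: "\<one> \<in> F"
    and filter_up: "\<lbrakk>x \<in> F; y \<in> carrier A; x \<preceq> y\<rbrakk> \<Longrightarrow> y \<in> F"
    and filter_meet: "\<lbrakk>x \<in> F; y \<in> F\<rbrakk> \<Longrightarrow> x \<curlywedge> y \<in> F"
begin

text \<open>The preorder whose symmetric part is the congruence given by \<open>F\<close>; it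
  becomes the order of the quotient.\<close>

abbreviation le_mod (infix "\<sqsubseteq>" 50) where "x \<sqsubseteq> y \<equiv> x \<leadsto> y \<in> F"

abbreviation r where "r \<equiv> filter_rep A F"

abbreviation Q where "Q \<equiv> irl_quotient A F"

text \<open>The meet of \<open>x\<close> and \<open>y\<close> lies in \<open>F\<close> and is below
  its own square, which is below \<open>x \<otimes> y\<close>. Here square-increasingness makes a
  lattice filter deductive.\<close>

lemma filter_mult:
  assumes "x \<in> F" "y \<in> F"
  shows "x \<otimes> y \<in> F"
proof (rule filter_up)
  show "x \<curlywedge> y \<in> F" using assms by (rule filter_meet)
  have c: "x \<in> carrier A" "y \<in> carrier A" using assms filter_subset by auto
  then show "x \<otimes> y \<in> carrier A" by simp
  have "x \<curlywedge> y \<preceq> (x \<curlywedge> y) \<otimes> (x \<curlywedge> y)"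
    using c by (intro square_increasing) (auto simp: closed)
  moreover have "(x \<curlywedge> y) \<otimes> (x \<curlywedge> y) \<preceq> x \<otimes> y"
    using c by (intro mult_mono) (auto simp: closed meet_le1 meet_le2)
  ultimately show "x \<curlywedge> y \<preceq> x \<otimes> y"
    using c by (meson closed le_trans m_closed)
qed

lemma le_mod_of_le: "\<lbrakk>x \<preceq> y; x \<in> carrier A; y \<in> carrier A\<rbrakk> \<Longrightarrow> x \<sqsubseteq> y"
  using filter_up[OF filter_one, of "x \<leadsto> y"] by (simp add: le_iff_one_le_imp closed)

lemma le_mod_trans: "\<lbrakk>x \<sqsubseteq> y; y \<sqsubseteq> z; x \<in> carrier A; y \<in> carrier A; z \<in> carrier A\<rbrakk> \<Longrightarrow> x \<sqsubseteq> z"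
  using filter_up[OF filter_mult _ imp_trans] by (simp add: closed)

lemma le_mod_neg: "\<lbrakk>x \<sqsubseteq> y; x \<in> carrier A; y \<in> carrier A\<rbrakk> \<Longrightarrow> \<sim> y \<sqsubseteq> \<sim> x"
  by (simp add: imp_contrapos)

lemma le_mod_mult:
  assumes "x \<sqsubseteq> y" "z \<sqsubseteq> w" "x \<in> carrier A" "y \<in> carrier A" "z \<in> carrier A" "w \<in> carrier A"
  shows "x \<otimes> z \<sqsubseteq> y \<otimes> w"
proof (rule le_mod_trans)
  show "x \<otimes> z \<sqsubseteq> x \<otimes> w" using assms filter_up[OF assms(2) _ imp_mult] by (simp add: closed)
  show "x \<otimes> w \<sqsubseteq> y \<otimes> w"
    using assms filter_up[OF assms(1) _ imp_mult[of x y w]] by (simp add: closed m_comm)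
qed (use assms in auto)

lemma le_mod_meetI:
  "\<lbrakk>z \<sqsubseteq> x; z \<sqsubseteq> y; x \<in> carrier A; y \<in> carrier A; z \<in> carrier A\<rbrakk> \<Longrightarrow> z \<sqsubseteq> x \<curlywedge> y"
  using filter_up[OF filter_meet _ imp_meet] by (simp add: closed)

lemma le_mod_joinI:
  "\<lbrakk>x \<sqsubseteq> z; y \<sqsubseteq> z; x \<in> carrier A; y \<in> carrier A; z \<in> carrier A\<rbrakk> \<Longrightarrow> x \<curlyvee> y \<sqsubseteq> z"
  using filter_up[OF filter_meet _ imp_join] by (simp add: closed)

lemma le_mod_meet:
  assumes "x \<sqsubseteq> y" "z \<sqsubseteq> w" "x \<in> carrier A" "y \<in> carrier A" "z \<in> carrier A" "w \<in> carrier A"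
  shows "x \<curlywedge> z \<sqsubseteq> y \<curlywedge> w"
  using assms le_mod_trans[OF le_mod_of_le[OF meet_le1] assms(1)]
    le_mod_trans[OF le_mod_of_le[OF meet_le2] assms(2)]
  by (intro le_mod_meetI) (auto simp: closed)

lemma le_mod_join:
  assumes "x \<sqsubseteq> y" "z \<sqsubseteq> w" "x \<in> carrier A" "y \<in> carrier A" "z \<in> carrier A" "w \<in> carrier A"
  shows "x \<curlyvee> z \<sqsubseteq> y \<curlyvee> w"
  using assms le_mod_trans[OF assms(1) le_mod_of_le[OF le_join1]]
    le_mod_trans[OF assms(2) le_mod_of_le[OF le_join2]]
  by (intro le_mod_joinI) (auto simp: closed)

lemma r_props: "x \<in> carrier A \<Longrightarrow> r x \<in> carrier A \<and> x \<sqsubseteq> r x \<and> r x \<sqsubseteq> x"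
  unfolding filter_rep_def by (rule someI[of _ x]) (simp add: le_mod_of_le)

lemma r_eq_iff:
  assumes "x \<in> carrier A" "y \<in> carrier A"
  shows "r x = r y \<longleftrightarrow> x \<sqsubseteq> y \<and> y \<sqsubseteq> x"
proof
  assume "r x = r y"
  then show "x \<sqsubseteq> y \<and> y \<sqsubseteq> x" using assms r_props le_mod_trans by metis
next
  assume "x \<sqsubseteq> y \<and> y \<sqsubseteq> x"
  \<comment> \<open>Equivalent elements admit the same candidates as representatives, so the choice
    operator picks the same one for both.\<close>
  then have "x \<sqsubseteq> z \<and> z \<sqsubseteq> x \<longleftrightarrow> y \<sqsubseteq> z \<and> z \<sqsubseteq> y" if "z \<in> carrier A" for z
    using assms that le_mod_trans by meson
  then show "r x = r y" unfolding filter_rep_def by (intro arg_cong[of _ _ Eps]) auto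
qed

lemma r_ops:
  assumes "x \<in> carrier A" "y \<in> carrier A"
  shows "r (\<sim> (r x)) = r (\<sim> x)" "r (r x \<otimes> r y) = r (x \<otimes> y)"
    "r (r x \<curlywedge> r y) = r (x \<curlywedge> y)" "r (r x \<curlyvee> r y) = r (x \<curlyvee> y)"
  using r_props[OF assms(1)] r_props[OF assms(2)] assms
  by (auto simp: r_eq_iff closed intro: le_mod_neg le_mod_mult le_mod_meet le_mod_join)

lemma quotient_carrier: "carrier Q = r ` carrier A"
  by (simp add: irl_quotient_def)

lemma quotient_ops:
  assumes "x \<in> carrier A" "y \<in> carrier A"
  shows "\<sim>\<^bsub>Q\<^esub> (r x) = r (\<sim> x)" "r x \<otimes>\<^bsub>Q\<^esub> r y = r (x \<otimes> y)"
    "r x \<curlywedge>\<^bsub>Q\<^esub> r y = r (x \<curlywedge> y)" "r x \<curlyvee>\<^bsub>Q\<^esub> r y = r (x \<curlyvee> y)"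
  using assms by (simp_all add: irl_quotient_def r_ops)

lemma quotient_one: "\<one>\<^bsub>Q\<^esub> = r \<one>"
  by (simp add: irl_quotient_def)

lemma r_hom: "r \<in> irl_hom A Q"
  by (auto simp: irl_hom_def quotient_ops quotient_one quotient_carrier)

lemma quotient_le:
  assumes "x \<in> carrier A" "y \<in> carrier A"
  shows "r x \<preceq>\<^bsub>Q\<^esub> r y \<longleftrightarrow> x \<sqsubseteq> y"
proof
  assume "r x \<preceq>\<^bsub>Q\<^esub> r y"
  then have "x \<sqsubseteq> x \<curlywedge> y"
    using assms by (simp add: lle_def quotient_ops r_eq_iff closed)
  then show "x \<sqsubseteq> y" using assms le_mod_of_le[OF meet_le2] le_mod_trans by (meson closed)
next
  assume "x \<sqsubseteq> y"
  then show "r x \<preceq>\<^bsub>Q\<^esub> r y"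
    using assms le_mod_meetI[OF le_mod_of_le[OF le_refl], of x y] le_mod_of_le[OF meet_le1, of x y]
    by (simp add: lle_def quotient_ops r_eq_iff closed)
qed

lemma quotient_de_morgan: "de_morgan_monoid Q"
proof -
  \<comment> \<open>Every element of \<open>Q\<close> has the form \<open>r x\<close>, which reduces
    each axiom to a statement about elements of \<open>A\<close>.\<close>
  have Ball_Q: "(\<forall>x \<in> carrier Q. P x) \<longleftrightarrow> (\<forall>x \<in> carrier A. P (r x))" for P
    by (simp add: quotient_carrier)
  note qs = quotient_ops quotient_one closed
  have cl: "r x \<in> carrier Q" if "x \<in> carrier A" for x
    using that by (simp add: quotient_carrier)
  have comm: "\<forall>x \<in> carrier Q. \<forall>y \<in> carrier Q. x \<otimes>\<^bsub>Q\<^esub> y \<in> carrier Q \<and> x \<curlywedge>\<^bsub>Q\<^esub> y \<in> carrier Q \<and>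
      x \<curlyvee>\<^bsub>Q\<^esub> y \<in> carrier Q \<and> x \<otimes>\<^bsub>Q\<^esub> y = y \<otimes>\<^bsub>Q\<^esub> x \<and> x \<curlywedge>\<^bsub>Q\<^esub> y = y \<curlywedge>\<^bsub>Q\<^esub> x \<and> x \<curlyvee>\<^bsub>Q\<^esub> y = y \<curlyvee>\<^bsub>Q\<^esub> x \<and>
      x \<curlywedge>\<^bsub>Q\<^esub> (x \<curlyvee>\<^bsub>Q\<^esub> y) = x \<and> x \<curlyvee>\<^bsub>Q\<^esub> (x \<curlywedge>\<^bsub>Q\<^esub> y) = x"
    unfolding Ball_Q using m_comm meet_comm join_comm
    by (simp add: qs cl meet_absorb join_absorb)
  have assoc: "\<forall>x \<in> carrier Q. \<forall>y \<in> carrier Q. \<forall>z \<in> carrier Q.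
      (x \<otimes>\<^bsub>Q\<^esub> y) \<otimes>\<^bsub>Q\<^esub> z = x \<otimes>\<^bsub>Q\<^esub> (y \<otimes>\<^bsub>Q\<^esub> z) \<and> (x \<curlywedge>\<^bsub>Q\<^esub> y) \<curlywedge>\<^bsub>Q\<^esub> z = x \<curlywedge>\<^bsub>Q\<^esub> (y \<curlywedge>\<^bsub>Q\<^esub> z) \<and>
      (x \<curlyvee>\<^bsub>Q\<^esub> y) \<curlyvee>\<^bsub>Q\<^esub> z = x \<curlyvee>\<^bsub>Q\<^esub> (y \<curlyvee>\<^bsub>Q\<^esub> z) \<and>
      x \<curlywedge>\<^bsub>Q\<^esub> (y \<curlyvee>\<^bsub>Q\<^esub> z) = (x \<curlywedge>\<^bsub>Q\<^esub> y) \<curlyvee>\<^bsub>Q\<^esub> (x \<curlywedge>\<^bsub>Q\<^esub> z)"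
    unfolding Ball_Q by (simp add: qs m_assoc meet_assoc join_assoc distrib)
  have unary: "\<forall>x \<in> carrier Q. \<one>\<^bsub>Q\<^esub> \<otimes>\<^bsub>Q\<^esub> x = x \<and> x \<otimes>\<^bsub>Q\<^esub> \<one>\<^bsub>Q\<^esub> = x \<and> \<sim>\<^bsub>Q\<^esub> x \<in> carrier Q \<and>
      \<sim>\<^bsub>Q\<^esub> (\<sim>\<^bsub>Q\<^esub> x) = x \<and> x \<preceq>\<^bsub>Q\<^esub> x \<otimes>\<^bsub>Q\<^esub> x"
    unfolding Ball_Q
    by (simp add: qs neg_neg cl quotient_le le_mod_of_le square_increasing)
  have "\<forall>x \<in> carrier Q. \<forall>y \<in> carrier Q. \<forall>z \<in> carrier Q.
      x \<otimes>\<^bsub>Q\<^esub> y \<preceq>\<^bsub>Q\<^esub> z \<longleftrightarrow> \<sim>\<^bsub>Q\<^esub> z \<otimes>\<^bsub>Q\<^esub> y \<preceq>\<^bsub>Q\<^esub> \<sim>\<^bsub>Q\<^esub> x"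
  proof -
    \<comment> \<open>The two inequalities hold in the quotient when these implications lie in
      \<open>F\<close>, and the implications are one and the same element of
      \<open>A\<close>.\<close>
    have "(x \<otimes> y) \<leadsto> z = (\<sim> z \<otimes> y) \<leadsto> \<sim> x"
      if "x \<in> carrier A" "y \<in> carrier A" "z \<in> carrier A" for x y z
      using that by (simp add: irl_imp_def closed neg_neg m_ac)
    then show ?thesis unfolding Ball_Q by (simp add: qs quotient_le)
  qed
  moreover have "\<one>\<^bsub>Q\<^esub> \<in> carrier Q" by (simp add: quotient_one cl)
  ultimately show ?thesis using comm assoc unary by unfold_locales blast+
qed

end

section \<open>Prime filters and their existence\<close>

locale prime_filter = deductive_filter +
  assumes prime: "\<lbrakk>x \<in> carrier A; y \<in> carrier A; x \<curlyvee> y \<in> F\<rbrakk> \<Longrightarrow> x \<in> F \<or> y \<in> F"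
begin

text \<open>As \<open>\<one> \<leadsto> x = x\<close>, the filter consists of the elements whose
  classes lie above the identity. Primeness of \<open>F\<close> thus becomes join-primeness of the
  identity.\<close>

lemma one_le_quotient_iff: "x \<in> carrier A \<Longrightarrow> \<one>\<^bsub>Q\<^esub> \<preceq>\<^bsub>Q\<^esub> r x \<longleftrightarrow> x \<in> F"
  by (simp add: quotient_one quotient_le one_imp)

lemma quotient_one_join_prime:
  assumes "x \<in> carrier Q" "y \<in> carrier Q" "\<one>\<^bsub>Q\<^esub> \<preceq>\<^bsub>Q\<^esub> x \<curlyvee>\<^bsub>Q\<^esub> y"
  shows "\<one>\<^bsub>Q\<^esub> \<preceq>\<^bsub>Q\<^esub> x \<or> \<one>\<^bsub>Q\<^esub> \<preceq>\<^bsub>Q\<^esub> y"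
  using assms
  by (auto simp: quotient_carrier quotient_ops one_le_quotient_iff closed dest: prime)

end

text \<open>Zorn's lemma, started from the set of elements above \<open>\<one>\<close>, gives a
  filter maximal among the deductive filters that omit \<open>c\<close>; distributivity then makes
  it prime.\<close>

lemma prime_filter_exists:
  fixes A :: "'a irl" (structure)
  assumes "de_morgan_monoid A" "c \<in> carrier A" "\<not> \<one> \<preceq> c"
  obtains F where "prime_filter A F" "c \<notin> F"
proof -
  interpret de_morgan_monoid A by fact
  define S where "S = {F. deductive_filter A F \<and> c \<notin> F}"
  have "deductive_filter A {x \<in> carrier A. \<one> \<preceq> x}"
  proof (unfold_locales, goal_cases)
    case (3 x y)
    then show ?case using le_trans[of \<one> x y] by simp
  qed (auto simp: closed le_meetI)
  then have "{x \<in> carrier A. \<one> \<preceq> x} \<in> S"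
    using assms by (simp add: S_def)
  then have "S \<noteq> {}" by blast
  moreover have "\<Union> C \<in> S" if "C \<noteq> {}" "subset.chain S C" for C
  proof -
    have C: "\<And>F. F \<in> C \<Longrightarrow> deductive_filter A F \<and> c \<notin> F"
      and total: "\<And>F G. F \<in> C \<Longrightarrow> G \<in> C \<Longrightarrow> F \<subseteq> G \<or> G \<subseteq> F"
      using that by (auto simp: subset_chain_def S_def)
    have "deductive_filter A (\<Union> C)"
    proof (unfold_locales, goal_cases)
      case 1
      then show ?case using C deductive_filter.filter_subset by (metis Union_least)
    next
      case 2
      then show ?case using C \<open>C \<noteq> {}\<close> deductive_filter.filter_one by (metis UnionI all_not_in_conv)
    next
      case (3 x y)
      then show ?case using C deductive_filter.filter_up by (metis Union_iff)
    next
      case (4 x y)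
      then obtain F G where "F \<in> C" "x \<in> F" "G \<in> C" "y \<in> G" by blast
      then obtain H where "H \<in> C" "x \<in> H" "y \<in> H" using total by blast
      then show ?case using C deductive_filter.filter_meet by (metis UnionI)
    qed
    then show ?thesis using C by (auto simp: S_def)
  qed
  ultimately obtain F where F: "F \<in> S" and maximal: "\<And>G. G \<in> S \<Longrightarrow> F \<subseteq> G \<Longrightarrow> G = F"
    using subset_Zorn_nonempty[of S] by blast
  interpret deductive_filter A F using F by (simp add: S_def)
  have le_c: "\<exists>f \<in> F. f \<curlywedge> a \<preceq> c" if a: "a \<in> carrier A" "a \<notin> F" for a
  proof -
    \<comment> \<open>\<open>G\<close> is the filter generated by \<open>F\<close> and
      \<open>a\<close>. It properly extends \<open>F\<close>, so by maximality it contains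
      \<open>c\<close>.\<close>
    define G where "G = {z \<in> carrier A. \<exists>f \<in> F. f \<curlywedge> a \<preceq> z}"
    have sub: "F \<subseteq> G"
      using filter_subset a meet_le1 by (auto simp: G_def)
    have "a \<in> G"
      using a filter_one meet_le2 by (auto simp: G_def)
    have "deductive_filter A G"
    proof (unfold_locales, goal_cases)
      case 1
      then show ?case by (auto simp: G_def)
    next
      case 2
      then show ?case using sub filter_one by blast
    next
      case (3 x y)
      then obtain f where f: "f \<in> F" "f \<curlywedge> a \<preceq> x" "x \<in> carrier A"
        unfolding G_def by blast
      then have "f \<curlywedge> a \<preceq> y"
        using 3 a filter_subset by (intro le_trans[OF f(2)]) (auto simp: closed)
      then show ?case using f 3 by (auto simp: G_def)
    next
      case (4 x y)
      then obtain f g where fg: "f \<in> F" "f \<curlywedge> a \<preceq> x" "g \<in> F" "g \<curlywedge> a \<preceq> y"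
        and xy: "x \<in> carrier A" "y \<in> carrier A"
        unfolding G_def by blast
      have c: "f \<in> carrier A" "g \<in> carrier A" using fg filter_subset by auto
      have "(f \<curlywedge> g) \<curlywedge> a \<preceq> f \<curlywedge> a" "(f \<curlywedge> g) \<curlywedge> a \<preceq> g \<curlywedge> a"
        using c a by (simp_all add: meet_mono meet_le1 meet_le2 closed)
      then have "(f \<curlywedge> g) \<curlywedge> a \<preceq> x \<curlywedge> y"
        using le_trans[OF _ fg(2)] le_trans[OF _ fg(4)] c a xy by (simp add: le_meetI closed)
      then show ?case using xy fg filter_meet by (auto simp: G_def closed)
    qed
    then have "G \<in> S \<or> c \<in> G" by (simp add: S_def)
    then show ?thesis using maximal[of G] sub \<open>a \<in> G\<close> a by (auto simp: G_def)
  qed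
  have "prime_filter A F"
  proof (unfold_locales, rule ccontr)
    fix x y assume xy: "x \<in> carrier A" "y \<in> carrier A" "x \<curlyvee> y \<in> F" "\<not> (x \<in> F \<or> y \<in> F)"
    then obtain f g where fg: "f \<in> F" "f \<curlywedge> x \<preceq> c" "g \<in> F" "g \<curlywedge> y \<preceq> c"
      using le_c by blast
    have c: "f \<in> carrier A" "g \<in> carrier A" using fg filter_subset by auto
    \<comment> \<open>The common witness \<open>f \<curlywedge> g\<close> serves both
      \<open>x\<close> and \<open>y\<close>, so by distributivity
      \<open>(f \<curlywedge> g) \<curlywedge> (x \<curlyvee> y)\<close>, a member of
      \<open>F\<close>, lies below \<open>c\<close>.\<close>
    have "(f \<curlywedge> g) \<curlywedge> x \<preceq> f \<curlywedge> x" "(f \<curlywedge> g) \<curlywedge> y \<preceq> g \<curlywedge> y"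
      using c xy by (simp_all add: meet_mono meet_le1 meet_le2 closed)
    then have "((f \<curlywedge> g) \<curlywedge> x) \<curlyvee> ((f \<curlywedge> g) \<curlywedge> y) \<preceq> c"
      using le_trans[OF _ fg(2)] le_trans[OF _ fg(4)] c xy assms(2) by (simp add: join_leI closed)
    then have "(f \<curlywedge> g) \<curlywedge> (x \<curlyvee> y) \<preceq> c" using c xy by (simp add: distrib closed)
    then have "c \<in> F" using filter_up[OF filter_meet[OF filter_meet[OF fg(1,3)] xy(3)]] assms(2) by blast
    then show False using F by (simp add: S_def)
  qed
  then show thesis using that F by (simp add: S_def)
qed

section \<open>Algebras in U with join-prime identity\<close>

text \<open>The properties of the quotients by prime filters. The last assumption rules out the
  trivial algebra and yields \<open>\<one> \<noteq> \<bbbzero>\<close>.\<close>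

locale join_prime_U = variety_U A for A :: "'a irl" (structure) +
  assumes one_join_prime:
      "\<lbrakk>x \<in> carrier A; y \<in> carrier A; \<one> \<preceq> x \<curlyvee> y\<rbrakk> \<Longrightarrow> \<one> \<preceq> x \<or> \<one> \<preceq> y"
    and not_one_le: "\<exists>x \<in> carrier A. \<not> \<one> \<preceq> x"
begin

section \<open>Top and bottom elements\<close>

abbreviation bot ("\<bbbzero>") where "\<bbbzero> \<equiv> \<sim> \<bbbone>"

text \<open>An element is below its square, which is a joinand in the first identity.\<close>

lemma le_top: "x \<in> carrier A \<Longrightarrow> x \<preceq> \<bbbone>"
  using le_trans[OF square_increasing[of x] le_join1[of "x \<otimes> x" "\<sim> x \<otimes> \<sim> x"]]
  by (simp add: closed U_square)

lemma bot_le: "x \<in> carrier A \<Longrightarrow> \<bbbzero> \<preceq> x"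
  using le_neg_iff[of "\<sim> x" \<bbbone>] le_top by (simp add: closed neg_neg)

lemma top_le: "\<lbrakk>\<bbbone> \<preceq> x; x \<in> carrier A\<rbrakk> \<Longrightarrow> x = \<bbbone>"
  using le_antisym le_top closed by blast

lemma le_bot: "\<lbrakk>x \<preceq> \<bbbzero>; x \<in> carrier A\<rbrakk> \<Longrightarrow> x = \<bbbzero>"
  using le_antisym bot_le closed by blast

lemma mult_bot: "x \<in> carrier A \<Longrightarrow> x \<otimes> \<bbbzero> = \<bbbzero>"
  using residuation[of x \<bbbzero> \<bbbzero>] bot_le le_bot by (simp add: closed)

lemma bot_mult: "x \<in> carrier A \<Longrightarrow> \<bbbzero> \<otimes> x = \<bbbzero>"
  by (simp add: mult_bot m_comm closed)

text \<open>Square-increasingness gives \<open>x \<curlywedge> \<sim> x \<preceq> x \<otimes> \<sim>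
  x \<preceq> \<sim> \<one>\<close>. Negated, this is
  \<open>\<one> \<preceq> \<sim> x \<curlyvee> x\<close>, to which join-primeness applies.\<close>

lemma one_le_or_le_f:
  assumes x: "x \<in> carrier A"
  shows "\<one> \<preceq> x \<or> x \<preceq> \<sim> \<one>"
proof -
  have f: "x \<otimes> \<sim> x \<preceq> \<sim> \<one>"
    using mult_imp_le[of x "\<sim> \<one>"] x by (simp add: irl_imp_def neg_neg closed)
  have "x \<curlywedge> \<sim> x \<preceq> (x \<curlywedge> \<sim> x) \<otimes> (x \<curlywedge> \<sim> x)"
    using x by (simp add: square_increasing closed)
  moreover have "(x \<curlywedge> \<sim> x) \<otimes> (x \<curlywedge> \<sim> x) \<preceq> x \<otimes> \<sim> x"
    using x by (simp add: mult_mono meet_le1 meet_le2 closed)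
  ultimately have "x \<curlywedge> \<sim> x \<preceq> x \<otimes> \<sim> x"
    using x by (auto simp: closed elim: le_trans)
  then have "x \<curlywedge> \<sim> x \<preceq> \<sim> \<one>"
    using le_trans[OF _ f] x by (simp add: closed)
  moreover have "x \<curlywedge> \<sim> x = \<sim> (\<sim> x \<curlyvee> x)"
    using x by (simp add: neg_join neg_neg closed)
  ultimately have "\<one> \<preceq> \<sim> x \<curlyvee> x"
    using x by (simp add: le_neg_iff closed)
  then show ?thesis
    using one_join_prime[of "\<sim> x" x] x le_neg_swap by (auto simp: closed)
qed

text \<open>The preceding dichotomy is applied to \<open>\<bbbone> \<otimes> x\<close>. If
  \<open>\<one>\<close> is below it, multiplying by the idempotent \<open>\<bbbone>\<close> gives
  \<open>\<bbbone> \<preceq> \<bbbone> \<otimes> x\<close>; if it is below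
  \<open>\<sim> \<one>\<close>, residuation forces \<open>x = \<bbbzero>\<close>.\<close>

lemma top_mult:
  assumes x: "x \<in> carrier A" "x \<noteq> \<bbbzero>"
  shows "\<bbbone> \<otimes> x = \<bbbone>"
proof -
  have sq: "\<bbbone> \<otimes> \<bbbone> = \<bbbone>"
    using square_increasing top_le by (simp add: closed)
  consider "\<one> \<preceq> \<bbbone> \<otimes> x" | "\<bbbone> \<otimes> x \<preceq> \<sim> \<one>"
    using one_le_or_le_f[of "\<bbbone> \<otimes> x"] x by (auto simp: closed)
  then show ?thesis
  proof cases
    case 1
    then have "\<bbbone> \<otimes> \<one> \<preceq> \<bbbone> \<otimes> (\<bbbone> \<otimes> x)"
      using x by (intro mult_mono_right) (auto simp: closed)
    then show ?thesis
      using x top_le by (simp add: closed sq flip: m_assoc)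
  next
    case 2
    then have "x \<preceq> \<bbbzero>"
      using x residuation[of "\<bbbone>" x "\<sim> \<one>"] by (simp add: closed irl_imp_def neg_neg)
    then show ?thesis using x le_bot by blast
  qed
qed

lemma mult_top: "\<lbrakk>x \<in> carrier A; x \<noteq> \<bbbzero>\<rbrakk> \<Longrightarrow> x \<otimes> \<bbbone> = \<bbbone>"
  using top_mult[of x] m_comm[of x \<bbbone>] by (simp add: closed)

lemma one_neq_bot: "\<one> \<noteq> \<bbbzero>"
  using not_one_le bot_le by auto

lemma top_neq_bot: "\<bbbone> \<noteq> \<bbbzero>"
  using one_neq_bot le_top[of \<one>] le_bot[of \<one>] by auto

text \<open>The implication is \<open>\<sim> (\<bbbone> \<otimes> \<sim> x)\<close>, and this
  product is \<open>\<bbbone>\<close> unless \<open>\<sim> x = \<bbbzero>\<close>.\<close>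

lemma top_imp:
  assumes x: "x \<in> carrier A"
  shows "\<bbbone> \<leadsto> x = (if x = \<bbbone> then \<bbbone> else \<bbbzero>)"
proof (cases "x = \<bbbone>")
  case True
  then show ?thesis by (simp add: irl_imp_def mult_bot neg_neg closed)
next
  case False
  then have "\<sim> x \<noteq> \<bbbzero>" using x neg_neg closed by metis
  then show ?thesis using x False by (simp add: irl_imp_def top_mult closed)
qed

text \<open>If neither joinand were \<open>\<bbbone>\<close>, the second identity would read
  \<open>\<bbbone> \<preceq> \<bbbzero> \<curlyvee> \<bbbzero>\<close>.\<close>

lemma top_join_irreducible:
  assumes "x \<in> carrier A" "y \<in> carrier A" "x \<curlyvee> y = \<bbbone>"
  shows "x = \<bbbone> \<or> y = \<bbbone>"
proof (rule ccontr)
  assume "\<not> (x = \<bbbone> \<or> y = \<bbbone>)"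
  then have "\<bbbone> \<preceq> \<bbbzero> \<curlyvee> \<bbbzero>"
    using U_join[of x y] assms by (simp add: top_imp closed)
  then have "\<bbbone> \<preceq> \<bbbzero>"
    using le_iff_join[of "\<bbbzero>" "\<bbbzero>"] by (simp add: closed)
  then show False using top_neq_bot le_bot closed by blast
qed

lemma bot_meet_irreducible:
  assumes "x \<in> carrier A" "y \<in> carrier A" "x \<curlywedge> y = \<bbbzero>"
  shows "x = \<bbbzero> \<or> y = \<bbbzero>"
proof -
  have "\<sim> x \<curlyvee> \<sim> y = \<bbbone>"
    using neg_join[of "\<sim> x" "\<sim> y"] assms neg_neg by (metis closed)
  then show ?thesis using top_join_irreducible[of "\<sim> x" "\<sim> y"] assms neg_neg by (metis closed)
qed

section \<open>The Dunn monoid inside the algebra\<close>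

definition dunn_set :: "'a set"
  where "dunn_set = {x \<in> carrier A. x \<noteq> \<bbbzero> \<and> \<sim> x \<otimes> \<sim> x = \<bbbone>}"

lemma dunn_setD: "x \<in> dunn_set \<Longrightarrow> x \<in> carrier A"
  and dunn_set_neq_bot: "x \<in> dunn_set \<Longrightarrow> x \<noteq> \<bbbzero>"
  and neg_square: "x \<in> dunn_set \<Longrightarrow> \<sim> x \<otimes> \<sim> x = \<bbbone>"
  by (auto simp: dunn_set_def)

text \<open>Implications from \<open>\<bbbone>\<close> are two-valued, so \<open>q_term\<close> is
  the indicator of the square condition in \<open>dunn_set\<close>. This lets the third identity be
  read as a closure property.\<close>

lemma q_term_eq:
  "x \<in> carrier A \<Longrightarrow> q_term A x = (if \<sim> x \<otimes> \<sim> x = \<bbbone> then \<bbbone> else \<bbbzero>)"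
  by (simp add: q_term_def top_imp closed)

lemma one_in_dunn_set: "\<one> \<in> dunn_set"
  using one_neq_bot by (simp add: dunn_set_def f_sq_def)

text \<open>On \<open>dunn_set\<close> the left side of the third identity is
  \<open>\<bbbone>\<close>, hence so are all four meetands on the right. Three of them give the
  square conditions; the fourth, \<open>\<bbbone> \<otimes> (x \<leadsto> y)\<close>, excludes
  \<open>x \<leadsto> y = \<bbbzero>\<close>.\<close>

lemma dunn_set_ops:
  assumes xy: "x \<in> dunn_set" "y \<in> dunn_set"
  shows "x \<otimes> y \<in> dunn_set" "x \<curlyvee> y \<in> dunn_set" "x \<leadsto> y \<in> dunn_set"
proof -
  note c = dunn_setD[OF xy(1)] dunn_setD[OF xy(2)]
  have top_xy: "\<bbbone> \<otimes> x \<otimes> y = \<bbbone>"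
    using c xy by (simp add: top_mult dunn_set_neq_bot)
  then have "\<bbbone> \<preceq> q_term A (x \<otimes> y) \<curlywedge> q_term A (x \<curlyvee> y) \<curlywedge>
      q_term A (x \<leadsto> y) \<curlywedge> (\<bbbone> \<otimes> (x \<leadsto> y))" (is "_ \<preceq> ?a \<curlywedge> ?b \<curlywedge> ?c \<curlywedge> ?d")
    using U_q[of x y] c xy neg_square by (simp add: q_term_eq top_mult top_neq_bot closed)
  moreover have cl: "?a \<in> carrier A" "?b \<in> carrier A" "?c \<in> carrier A" "?d \<in> carrier A"
    using c by (auto simp: closed)
  ultimately have eq: "?a \<curlywedge> ?b \<curlywedge> ?c \<curlywedge> ?d = \<bbbone>" by (simp add: top_le closed)
  then have 1: "?a \<curlywedge> ?b \<curlywedge> ?c = \<bbbone>" "?d = \<bbbone>"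
    using meet_le1[of "?a \<curlywedge> ?b \<curlywedge> ?c" ?d] meet_le2[of "?a \<curlywedge> ?b \<curlywedge> ?c" ?d] cl top_le closed by auto
  then have 2: "?a \<curlywedge> ?b = \<bbbone>" "?c = \<bbbone>"
    using meet_le1[of "?a \<curlywedge> ?b" ?c] meet_le2[of "?a \<curlywedge> ?b" ?c] cl top_le closed by auto
  then have 3: "?a = \<bbbone>" "?b = \<bbbone>"
    using meet_le1[of "?a" ?b] meet_le2[of "?a" ?b] cl top_le closed by auto
  have "x \<otimes> y \<noteq> \<bbbzero>"
    using top_xy top_neq_bot c mult_bot[of \<bbbone>] by (auto simp: m_assoc closed)
  then show "x \<otimes> y \<in> dunn_set"
    using 3 c top_neq_bot by (auto simp: dunn_set_def q_term_eq closed split: if_splits)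
  have "x \<curlyvee> y \<noteq> \<bbbzero>"
    using le_join1[of x y] c dunn_set_neq_bot[OF xy(1)] le_bot[of x] by auto
  then show "x \<curlyvee> y \<in> dunn_set"
    using 3 c top_neq_bot by (auto simp: dunn_set_def q_term_eq closed split: if_splits)
  have "x \<leadsto> y \<noteq> \<bbbzero>"
    using 1 top_neq_bot mult_bot[of \<bbbone>] by (auto simp: closed)
  then show "x \<leadsto> y \<in> dunn_set"
    using 2 c top_neq_bot by (auto simp: dunn_set_def q_term_eq closed split: if_splits)
qed

text \<open>The square condition passes to meets because \<open>\<sim> (x \<curlywedge> y)\<close>
  is above \<open>\<sim> x\<close>; the meet is nonzero because \<open>\<bbbzero>\<close> is
  meet-irreducible.\<close>

lemma dunn_set_meet:
  assumes xy: "x \<in> dunn_set" "y \<in> dunn_set"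
  shows "x \<curlywedge> y \<in> dunn_set"
proof -
  note c = dunn_setD[OF xy(1)] dunn_setD[OF xy(2)]
  have "\<sim> x \<preceq> \<sim> (x \<curlywedge> y)" using c by (simp add: le_neg_iff meet_le1 closed)
  then have "\<sim> x \<otimes> \<sim> x \<preceq> \<sim> (x \<curlywedge> y) \<otimes> \<sim> (x \<curlywedge> y)"
    using c by (simp add: mult_mono closed)
  then have "\<sim> (x \<curlywedge> y) \<otimes> \<sim> (x \<curlywedge> y) = \<bbbone>"
    using c xy neg_square by (simp add: top_le closed)
  then show ?thesis
    using c xy bot_meet_irreducible[of x y] by (auto simp: dunn_set_def closed)
qed

text \<open>Both factors are above \<open>\<sim> (x \<curlyvee> y)\<close>, whose square is
  \<open>\<bbbone>\<close> by closure under joins. This matches the product of two copies in a skew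
  reflection.\<close>

lemma neg_mult_neg:
  assumes xy: "x \<in> dunn_set" "y \<in> dunn_set"
  shows "\<sim> x \<otimes> \<sim> y = \<bbbone>"
proof -
  note c = dunn_setD[OF xy(1)] dunn_setD[OF xy(2)]
  have "\<sim> (x \<curlyvee> y) \<otimes> \<sim> (x \<curlyvee> y) \<preceq> \<sim> x \<otimes> \<sim> y"
    using c by (intro mult_mono) (auto simp: le_neg_iff le_join1 le_join2 closed)
  then show ?thesis
    using c neg_square[OF dunn_set_ops(2)[OF xy]] by (simp add: top_le closed)
qed

lemma top_notin_dunn_set: "\<bbbone> \<notin> dunn_set"
  using top_neq_bot by (simp add: dunn_set_def neg_neg mult_bot closed)

text \<open>Squaring \<open>\<sim> x \<preceq> y\<close> would give
  \<open>y \<otimes> y = \<bbbone>\<close>, but \<open>dunn_set\<close> is closed under products and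
  does not contain \<open>\<bbbone>\<close>.\<close>

lemma not_neg_le:
  assumes xy: "x \<in> dunn_set" "y \<in> dunn_set"
  shows "\<not> \<sim> x \<preceq> y"
proof
  note c = dunn_setD[OF xy(1)] dunn_setD[OF xy(2)]
  assume "\<sim> x \<preceq> y"
  then have "\<sim> x \<otimes> \<sim> x \<preceq> y \<otimes> y" using c by (simp add: mult_mono closed)
  then have "y \<otimes> y = \<bbbone>" using c xy neg_square by (simp add: top_le closed)
  then show False using dunn_set_ops(1)[OF xy(2,2)] top_notin_dunn_set by simp
qed

lemma neg_notin_dunn_set: "x \<in> dunn_set \<Longrightarrow> \<sim> x \<notin> dunn_set"
  using not_neg_le[of x "\<sim> x"] by (auto simp: dunn_setD closed)

text \<open>By join-irreducibility of \<open>\<bbbone>\<close>, the first identity makes one of the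
  two squares equal to \<open>\<bbbone>\<close>.\<close>

lemma cases_dunn_set:
  assumes "x \<in> carrier A"
  obtains "x = \<bbbzero>" | "x = \<bbbone>" | "x \<in> dunn_set" | "\<sim> x \<in> dunn_set"
proof -
  have "x \<otimes> x = \<bbbone> \<or> \<sim> x \<otimes> \<sim> x = \<bbbone>"
    using assms U_square[of x] by (intro top_join_irreducible) (auto simp: closed)
  moreover have "x \<noteq> \<bbbone> \<Longrightarrow> \<sim> x \<noteq> \<bbbzero>" using assms neg_neg closed by metis
  ultimately show thesis
    using assms that by (auto simp: dunn_set_def neg_neg closed)
qed

definition dunn_part :: "'a rl"
  where "dunn_part =
    \<lparr>carrier = dunn_set, monoid.mult = mult A, one = one A, lmeet = lmeet A, ljoin = ljoin A,
     rimp = irl_imp A\<rparr>"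

lemma dunn_part_simps:
  "carrier dunn_part = dunn_set" "monoid.mult dunn_part = mult A" "one dunn_part = one A"
  "lmeet dunn_part = lmeet A" "ljoin dunn_part = ljoin A" "rimp dunn_part = irl_imp A"
  "x \<preceq>\<^bsub>dunn_part\<^esub> y \<longleftrightarrow> x \<preceq> y"
  by (simp_all add: dunn_part_def lle_def)

lemma dunn_monoid_dunn_part: "dunn_monoid dunn_part"
  by unfold_locales
    (auto simp: dunn_part_simps dunn_setD dunn_set_ops dunn_set_meet one_in_dunn_set m_assoc
      meet_assoc join_assoc meet_absorb join_absorb square_increasing residuation
      intro: distrib m_comm meet_comm join_comm)

section \<open>Identification with a skew reflection\<close>

fun of_skew :: "'a skew \<Rightarrow> 'a"
  where
    "of_skew Zero = \<bbbzero>"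
  | "of_skew One = \<bbbone>"
  | "of_skew (Base b) = b"
  | "of_skew (Copy b) = \<sim> b"

text \<open>Pulling the order back along \<open>of_skew\<close> makes it a lattice order by
  transport, so only the compatibility conditions of \<open>skew_order\<close> remain to be
  checked.\<close>

abbreviation skew_le where "skew_le s t \<equiv> of_skew s \<preceq> of_skew t"

abbreviation SR where "SR \<equiv> skew_reflection dunn_part skew_le"

abbreviation skews where "skews \<equiv> skew_carrier dunn_part"

lemma skews_iff:
  "Base b \<in> skews \<longleftrightarrow> b \<in> dunn_set" "Copy b \<in> skews \<longleftrightarrow> b \<in> dunn_set"
  "Zero \<in> skews" "One \<in> skews"
  by (auto simp: skew_carrier_def dunn_part_simps)

lemma skews_cases:
  assumes "s \<in> skews"
  obtains "s = Zero" | "s = One" | b where "b \<in> dunn_set" "s = Base b"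
    | b where "b \<in> dunn_set" "s = Copy b"
  using assms by (auto simp: skew_carrier_def dunn_part_simps)

lemma dunn_set_neq:
  assumes "b \<in> dunn_set"
  shows "b \<noteq> \<bbbzero>" "b \<noteq> \<bbbone>" "\<sim> b \<noteq> \<bbbzero>" "\<sim> b \<noteq> \<bbbone>"
    and "c \<in> dunn_set \<Longrightarrow> b \<noteq> \<sim> c"
  using assms top_notin_dunn_set dunn_set_neq_bot neg_notin_dunn_set
  by (auto simp: neg_eq_iff neg_neg dunn_setD closed)

lemma bij_of_skew: "bij_betw of_skew skews (carrier A)"
proof (rule bij_betw_imageI)
  have "b = c" if "b \<in> dunn_set" "c \<in> dunn_set" "\<sim> b = \<sim> c" for b c
    using that by (simp add: neg_eq_iff neg_neg dunn_setD closed)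
  then show "inj_on of_skew skews"
    using top_neq_bot
    by (intro inj_onI)
      (auto elim!: skews_cases simp: dunn_set_neq dunn_set_neq[symmetric])
  show "of_skew ` skews = carrier A"
  proof (intro equalityI subsetI)
    fix x assume "x \<in> of_skew ` skews"
    then show "x \<in> carrier A" by (auto elim!: skews_cases simp: closed dunn_setD)
  next
    fix x assume x: "x \<in> carrier A"
    then have "\<exists>s \<in> skews. of_skew s = x"
    proof (cases rule: cases_dunn_set)
      case 4
      \<comment> \<open>Here \<open>x\<close> is the negation of the member \<open>\<sim> x\<close>
        of \<open>dunn_set\<close>, so the copy of \<open>\<sim> x\<close> decodes to it.\<close>
      then show ?thesis using x
        by (intro bexI[of _ "Copy (\<sim> x)"]) (auto simp: skews_iff neg_neg)
    qed (use skews_iff of_skew.simps in metis)+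
    then show "x \<in> of_skew ` skews" by blast
  qed
qed

lemma of_skew_closed: "s \<in> skews \<Longrightarrow> of_skew s \<in> carrier A"
  using bij_of_skew by (auto simp: bij_betw_def)

text \<open>The mixed condition is residuation: \<open>b \<preceq> \<sim> c\<close> means
  \<open>\<one> \<preceq> b \<leadsto> \<sim> c\<close>, and this implication is
  \<open>\<sim> (b \<otimes> c)\<close>.\<close>

lemma skew_order_skew_le: "skew_order dunn_part skew_le"
proof -
  have "b \<preceq> \<sim> c \<longleftrightarrow> \<one> \<preceq> \<sim> (b \<otimes> c)" if "b \<in> dunn_set" "c \<in> dunn_set" for b c
    using that le_iff_one_le_imp[of b "\<sim> c"] by (simp add: irl_imp_def neg_neg dunn_setD closed)
  moreover have "\<sim> b \<preceq> \<sim> c \<longleftrightarrow> c \<preceq> b" "\<not> \<sim> b \<preceq> c" if "b \<in> dunn_set" "c \<in> dunn_set" for b c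
    using that by (simp_all add: not_neg_le le_neg_iff dunn_setD)
  moreover have "\<bbbzero> \<preceq> b \<and> b \<preceq> \<bbbone> \<and> \<bbbzero> \<preceq> \<sim> b \<and> \<sim> b \<preceq> \<bbbone>" if "b \<in> dunn_set" for b
    using that by (simp add: bot_le le_top dunn_setD closed)
  ultimately show ?thesis
    using transported_lattice(1)[OF bij_of_skew]
    unfolding skew_order_def dunn_part_simps of_skew.simps by blast
qed

text \<open>Products are compared clause by clause with \<open>skew_mult\<close>; the mixed clause
  rests on \<open>\<sim> (b \<leadsto> c) = b \<otimes> \<sim> c\<close>. The lattice operations
  come from the transport.\<close>

lemma of_skew_ops:
  assumes s: "s \<in> skews" and t: "t \<in> skews"
  shows "of_skew (s \<otimes>\<^bsub>SR\<^esub> t) = of_skew s \<otimes> of_skew t"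
    and "of_skew (s \<curlywedge>\<^bsub>SR\<^esub> t) = of_skew s \<curlywedge> of_skew t"
    and "of_skew (s \<curlyvee>\<^bsub>SR\<^esub> t) = of_skew s \<curlyvee> of_skew t"
proof -
  show "of_skew (s \<otimes>\<^bsub>SR\<^esub> t) = of_skew s \<otimes> of_skew t"
    using s t top_neq_bot m_comm
    by (auto elim!: skews_cases simp: skew_reflection_def dunn_part_simps mult_bot bot_mult top_mult
        mult_top dunn_setD dunn_set_neq neg_mult_neg irl_imp_def neg_neg closed)
  show "of_skew (s \<curlywedge>\<^bsub>SR\<^esub> t) = of_skew s \<curlywedge> of_skew t" "of_skew (s \<curlyvee>\<^bsub>SR\<^esub> t) = of_skew s \<curlyvee> of_skew t"
    using transported_lattice(2,3)[OF bij_of_skew s t] by (simp_all add: skew_reflection_def)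
qed

lemma of_skew_neg: "s \<in> skews \<Longrightarrow> of_skew (\<sim>\<^bsub>SR\<^esub> s) = \<sim> of_skew s"
  by (auto elim!: skews_cases simp: skew_reflection_def dunn_setD neg_neg closed)

definition to_skew :: "'a \<Rightarrow> 'a skew"
  where "to_skew = inv_into skews of_skew"

lemma bij_to_skew: "bij_betw to_skew (carrier A) skews"
  unfolding to_skew_def using bij_of_skew by (rule bij_betw_inv_into)

lemma of_skew_to_skew: "x \<in> carrier A \<Longrightarrow> of_skew (to_skew x) = x"
  unfolding to_skew_def using bij_of_skew by (rule bij_betw_inv_into_right)

lemma to_skew_of_skew: "s \<in> skews \<Longrightarrow> to_skew (of_skew s) = s"
  unfolding to_skew_def using bij_of_skew by (rule bij_betw_inv_into_left)

lemma SR_carrier: "carrier SR = skews"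
  by (simp add: skew_reflection_def)

lemma SR_closed:
  assumes s: "s \<in> skews" and t: "t \<in> skews"
  shows "s \<otimes>\<^bsub>SR\<^esub> t \<in> skews" "s \<curlywedge>\<^bsub>SR\<^esub> t \<in> skews" "s \<curlyvee>\<^bsub>SR\<^esub> t \<in> skews"
proof -
  interpret L: Lattice.lattice "skew_gorder dunn_part skew_le"
    using skew_order_skew_le by (simp add: skew_order_def)
  show "s \<curlywedge>\<^bsub>SR\<^esub> t \<in> skews" "s \<curlyvee>\<^bsub>SR\<^esub> t \<in> skews"
    using L.meet_closed[of s t] L.join_closed[of s t] s t by (simp_all add: skew_reflection_def)
  show "s \<otimes>\<^bsub>SR\<^esub> t \<in> skews"
    using s t
    by (auto elim!: skews_cases simp: skew_reflection_def skews_iff dunn_part_simps dunn_set_ops)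
qed

lemma SR_neg_closed: "s \<in> skews \<Longrightarrow> \<sim>\<^bsub>SR\<^esub> s \<in> skews"
  by (auto elim!: skews_cases simp: skew_reflection_def skews_iff)

lemma to_skew_hom: "to_skew \<in> irl_hom A SR"
proof -
  have cl: "to_skew x \<in> skews" if "x \<in> carrier A" for x
    using bij_to_skew that by (auto simp: bij_betw_def)
  \<comment> \<open>Equations for \<open>to_skew\<close> may be checked after decoding, since
    \<open>of_skew\<close> is injective on \<open>skews\<close>.\<close>
  have eqI: "to_skew x = s" if "of_skew s = x" "s \<in> skews" for s x
    using that to_skew_of_skew by blast
  have "Base \<one> \<in> skews"
    by (simp add: skews_iff one_in_dunn_set)
  then have "to_skew \<one> = \<one>\<^bsub>SR\<^esub>"
    by (intro eqI) (auto simp: skew_reflection_def dunn_part_simps)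
  then show ?thesis
    by (auto simp: irl_hom_def SR_carrier cl SR_closed SR_neg_closed of_skew_ops of_skew_neg
        of_skew_to_skew intro!: eqI)
qed

lemma skew_reflection_representation:
  "dunn_monoid dunn_part" "is_skew_reflection dunn_part SR" "meet_irreducible SR Zero"
  "to_skew \<in> irl_hom A SR" "bij_betw to_skew (carrier A) (carrier SR)"
proof -
  show "dunn_monoid dunn_part" by (rule dunn_monoid_dunn_part)
  then show "is_skew_reflection dunn_part SR"
    using skew_order_skew_le by (auto simp: is_skew_reflection_def dunn_monoid_def)
  have "Zero \<in> skews" by (simp add: skews_iff)
  moreover have "s = Zero \<or> t = Zero" if "s \<in> skews" "t \<in> skews" "s \<curlywedge>\<^bsub>SR\<^esub> t = Zero" for s t
  proof -
    have "of_skew s = \<bbbzero> \<or> of_skew t = \<bbbzero>"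
      using that of_skew_ops(2)[of s t] bot_meet_irreducible[of "of_skew s" "of_skew t"]
      by (simp add: of_skew_closed)
    then show ?thesis
      using that to_skew_of_skew \<open>Zero \<in> skews\<close> of_skew.simps(1) by metis
  qed
  ultimately show "meet_irreducible SR Zero"
    by (auto simp: meet_irreducible_def SR_carrier)
  show "to_skew \<in> irl_hom A SR" by (rule to_skew_hom)
  show "bij_betw to_skew (carrier A) (carrier SR)"
    using bij_to_skew by (simp add: SR_carrier)
qed

end

section \<open>Skew reflections with meet-irreducible zero\<close>

locale zero_irreducible_skew_reflection = residuated_lattice B for B :: "'b rl" (structure) +
  fixes leq :: "'b skew \<Rightarrow> 'b skew \<Rightarrow> bool"
  assumes skew_order: "skew_order B leq"
    and zero_irreducible: "meet_irreducible (skew_reflection B leq) Zero"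
begin

section \<open>Order and negation of a skew reflection\<close>

abbreviation S where "S \<equiv> skew_reflection B leq"

abbreviation L where "L \<equiv> skew_gorder B leq"

sublocale L: Lattice.lattice L
  using skew_order by (simp add: skew_order_def)

lemma S_simps:
  "carrier S = skew_carrier B" "monoid.mult S = skew_mult B" "one S = Base \<one>"
  "lmeet S = Lattice.meet L" "ljoin S = Lattice.join L" "neg S = skew_neg"
  by (simp_all add: skew_reflection_def)

lemma skew_carrier_iff [simp]:
  "Base b \<in> skew_carrier B \<longleftrightarrow> b \<in> carrier B" "Copy b \<in> skew_carrier B \<longleftrightarrow> b \<in> carrier B"
  "Zero \<in> skew_carrier B" "One \<in> skew_carrier B"
  by (auto simp: skew_carrier_def)

lemma skew_carrier_cases:
  assumes "s \<in> skew_carrier B"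
  obtains "s = Zero" | "s = One" | b where "b \<in> carrier B" "s = Base b"
    | b where "b \<in> carrier B" "s = Copy b"
  using assms by (auto simp: skew_carrier_def)

lemma leq_refl: "s \<in> skew_carrier B \<Longrightarrow> leq s s"
  using L.le_refl by simp

lemma leq_antisym: "\<lbrakk>leq s t; leq t s; s \<in> skew_carrier B; t \<in> skew_carrier B\<rbrakk> \<Longrightarrow> s = t"
  using L.le_antisym by simp

lemma leq_trans:
  "\<lbrakk>leq s t; leq t u; s \<in> skew_carrier B; t \<in> skew_carrier B; u \<in> skew_carrier B\<rbrakk> \<Longrightarrow> leq s u"
  using L.le_trans by simp

lemma zero_leq: "s \<in> skew_carrier B \<Longrightarrow> leq Zero s"
  and leq_one: "s \<in> skew_carrier B \<Longrightarrow> leq s One"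
proof -
  have ends: "leq Zero (Base b)" "leq (Base b) One" "leq Zero (Copy b)" "leq (Copy b) One"
    if "b \<in> carrier B" for b
    using that skew_order by (auto simp: skew_order_def)
  then have "leq Zero One"
    using leq_trans[of Zero "Base \<one>" One] by simp
  then show "s \<in> skew_carrier B \<Longrightarrow> leq Zero s" "s \<in> skew_carrier B \<Longrightarrow> leq s One"
    by (auto elim!: skew_carrier_cases simp: ends leq_refl)
qed

lemma skew_neg_neg [simp]: "skew_neg (skew_neg s) = s"
  by (cases s) simp_all

lemma skew_neg_closed: "s \<in> skew_carrier B \<Longrightarrow> skew_neg s \<in> skew_carrier B"
  by (auto elim!: skew_carrier_cases)

lemma skew_mult_closed: "\<lbrakk>s \<in> skew_carrier B; t \<in> skew_carrier B\<rbrakk> \<Longrightarrow> skew_mult B s t \<in> skew_carrier B"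
  by (auto elim!: skew_carrier_cases simp: imp_closed)

lemma S_meet_closed: "\<lbrakk>s \<in> skew_carrier B; t \<in> skew_carrier B\<rbrakk> \<Longrightarrow> s \<curlywedge>\<^bsub>S\<^esub> t \<in> skew_carrier B"
  and S_join_closed: "\<lbrakk>s \<in> skew_carrier B; t \<in> skew_carrier B\<rbrakk> \<Longrightarrow> s \<curlyvee>\<^bsub>S\<^esub> t \<in> skew_carrier B"
  using L.meet_closed[of s t] L.join_closed[of s t] by (simp_all add: S_simps)

lemma S_join_leq:
  "\<lbrakk>s \<in> skew_carrier B; t \<in> skew_carrier B\<rbrakk> \<Longrightarrow> leq s (s \<curlyvee>\<^bsub>S\<^esub> t) \<and> leq t (s \<curlyvee>\<^bsub>S\<^esub> t)"
  using L.join_left[of s t] L.join_right[of s t] by (simp add: S_simps)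

lemma S_join_leI:
  "\<lbrakk>leq s u; leq t u; s \<in> skew_carrier B; t \<in> skew_carrier B; u \<in> skew_carrier B\<rbrakk>
    \<Longrightarrow> leq (s \<curlyvee>\<^bsub>S\<^esub> t) u"
  using L.join_le[of s u t] by (simp add: S_simps)

lemma S_meet_leq:
  "\<lbrakk>s \<in> skew_carrier B; t \<in> skew_carrier B\<rbrakk> \<Longrightarrow> leq (s \<curlywedge>\<^bsub>S\<^esub> t) s \<and> leq (s \<curlywedge>\<^bsub>S\<^esub> t) t"
  using L.meet_left[of s t] L.meet_right[of s t] by (simp add: S_simps)

lemma S_le_iff:
  assumes "s \<in> skew_carrier B" "t \<in> skew_carrier B"
  shows "s \<preceq>\<^bsub>S\<^esub> t \<longleftrightarrow> leq s t"
proof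
  assume "s \<preceq>\<^bsub>S\<^esub> t"
  then show "leq s t" using S_meet_leq[OF assms] by (simp add: lle_def)
next
  assume "leq s t"
  then have "leq s (s \<curlywedge>\<^bsub>S\<^esub> t)"
    using L.meet_le[of s s t] assms leq_refl by (simp add: S_simps)
  then show "s \<preceq>\<^bsub>S\<^esub> t"
    unfolding lle_def using assms S_meet_leq S_meet_closed leq_antisym by blast
qed

lemma one_join:
  "s \<in> skew_carrier B \<Longrightarrow> One \<curlyvee>\<^bsub>S\<^esub> s = One" "s \<in> skew_carrier B \<Longrightarrow> s \<curlyvee>\<^bsub>S\<^esub> One = One"
  using S_join_leq[of One s] S_join_leq[of s One] S_join_closed[of One s] S_join_closed[of s One]
    leq_one leq_antisym by auto

text \<open>In the mixed case \<open>leq (Base b) (Copy c)\<close> depends only on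
  \<open>b \<otimes> c\<close>, so commutativity lets \<open>b\<close> and \<open>c\<close> change
  places.\<close>

lemma skew_neg_antimono:
  assumes "leq s t" "s \<in> skew_carrier B" "t \<in> skew_carrier B"
  shows "leq (skew_neg t) (skew_neg s)"
proof -
  have "s = Zero" if "leq s Zero" using that assms zero_leq leq_antisym by auto
  moreover have "t = One" if "leq One t" using that assms leq_one leq_antisym by auto
  moreover have "leq (Base c) (Copy b)" if "leq (Base b) (Copy c)" "b \<in> carrier B" "c \<in> carrier B" for b c
    using that skew_order m_comm[of b c] unfolding skew_order_def by metis
  moreover have "leq (Base b) (Base c) \<longleftrightarrow> leq (Copy c) (Copy b)" "\<not> leq (Copy b) (Base c)"
    if "b \<in> carrier B" "c \<in> carrier B" for b c
    using that skew_order by (auto simp: skew_order_def)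
  ultimately show ?thesis
    using assms by (auto elim!: skew_carrier_cases simp: zero_leq leq_one leq_refl)
qed

text \<open>Negation is an antitone involution that exchanges \<open>Zero\<close> and
  \<open>One\<close>, so this is dual to the meet-irreducibility of \<open>Zero\<close>.\<close>

lemma one_join_irreducible:
  assumes st: "s \<in> skew_carrier B" "t \<in> skew_carrier B" "s \<curlyvee>\<^bsub>S\<^esub> t = One"
  shows "s = One \<or> t = One"
proof -
  let ?m = "skew_neg s \<curlywedge>\<^bsub>S\<^esub> skew_neg t"
  have m: "?m \<in> skew_carrier B" using st by (simp add: S_meet_closed skew_neg_closed)
  have "leq s (skew_neg ?m)" "leq t (skew_neg ?m)"
    using skew_neg_antimono[of ?m "skew_neg s"] skew_neg_antimono[of ?m "skew_neg t"]
      S_meet_leq[of "skew_neg s" "skew_neg t"] st m by (simp_all add: skew_neg_closed)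
  then have "leq One (skew_neg ?m)"
    using S_join_leI[of s "skew_neg ?m" t] st m by (simp add: skew_neg_closed)
  then have "skew_neg ?m = One"
    using leq_one leq_antisym m skew_neg_closed by auto
  then have "?m = Zero" by (metis skew_neg_neg skew_neg.simps(2))
  then have "skew_neg s = Zero \<or> skew_neg t = Zero"
    using zero_irreducible st by (simp add: meet_irreducible_def S_simps(1) skew_neg_closed)
  then show ?thesis by (metis skew_neg_neg skew_neg.simps(1))
qed

text \<open>The other three forms are excluded: the join is above \<open>Base b\<close>, so it is
  not \<open>Zero\<close>; it is below \<open>Base (b \<curlyvee> c)\<close>, so it is not a copy;
  and \<open>One\<close> is join-irreducible.\<close>

lemma base_join_base:
  assumes "b \<in> carrier B" "c \<in> carrier B"
  obtains d where "d \<in> carrier B" "Base b \<curlyvee>\<^bsub>S\<^esub> Base c = Base d"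
proof -
  let ?j = "Base b \<curlyvee>\<^bsub>S\<^esub> Base c"
  have j: "?j \<in> skew_carrier B" using assms by (simp add: S_join_closed)
  have neq: "?j \<noteq> Copy d" if "d \<in> carrier B" for d
  proof
    assume *: "?j = Copy d"
    have "leq ?j (Base (b \<curlyvee> c))"
      using assms skew_order le_join1[of b c] le_join2[of b c]
      by (intro S_join_leI) (auto simp: skew_order_def join_closed)
    then show False using * that assms skew_order by (auto simp: skew_order_def join_closed)
  qed
  have "?j \<noteq> One" using assms one_join_irreducible[of "Base b" "Base c"] by auto
  moreover have "?j \<noteq> Zero"
    using S_join_leq[of "Base b" "Base c"] zero_leq[of "Base b"] leq_antisym[of "Base b" Zero] assms by auto
  ultimately show thesis using j neq that by (auto elim: skew_carrier_cases)
qed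

section \<open>Evaluation of the identities in a skew reflection\<close>

lemma S_f_sq: "\<bbbone>\<^bsub>S\<^esub> = One"
  by (simp add: f_sq_def S_simps)

lemma S_one_imp: "\<bbbone>\<^bsub>S\<^esub> \<leadsto>\<^bsub>S\<^esub> s = (if s = One then One else Zero)"
  by (cases s) (simp_all add: irl_imp_def S_simps S_f_sq)

lemma S_q_term:
  "q_term S Zero = One" "q_term S One = Zero" "q_term S (Base b) = One" "q_term S (Copy b) = Zero"
  by (simp_all add: q_term_def S_one_imp) (simp_all add: S_simps)

lemma S_square:
  assumes "s \<in> skew_carrier B"
  shows "(s \<otimes>\<^bsub>S\<^esub> s) \<curlyvee>\<^bsub>S\<^esub> (\<sim>\<^bsub>S\<^esub> s \<otimes>\<^bsub>S\<^esub> \<sim>\<^bsub>S\<^esub> s) = \<bbbone>\<^bsub>S\<^esub>"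
  using assms one_join by (auto elim!: skew_carrier_cases simp: S_f_sq S_simps)

text \<open>The left side is \<open>Zero\<close> unless the join is \<open>One\<close>; then
  join-irreducibility makes \<open>s\<close> or \<open>t\<close> equal to \<open>One\<close>, and
  the right side is \<open>One\<close> too.\<close>

lemma S_one_imp_join:
  assumes "s \<in> skew_carrier B" "t \<in> skew_carrier B"
  shows "\<bbbone>\<^bsub>S\<^esub> \<leadsto>\<^bsub>S\<^esub> (s \<curlyvee>\<^bsub>S\<^esub> t) \<preceq>\<^bsub>S\<^esub> (\<bbbone>\<^bsub>S\<^esub> \<leadsto>\<^bsub>S\<^esub> s) \<curlyvee>\<^bsub>S\<^esub> (\<bbbone>\<^bsub>S\<^esub> \<leadsto>\<^bsub>S\<^esub> t)"
  using assms one_join_irreducible[OF assms] one_join leq_refl[of One] zero_leq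
  by (auto simp: S_one_imp S_le_iff S_join_closed)

text \<open>The left side is \<open>Zero\<close> unless both arguments are base elements, as
  \<open>Zero\<close> annihilates and \<open>q_term\<close> is \<open>Zero\<close> on
  \<open>One\<close> and on copies. For base elements the product, join and implication are base
  elements again, so every meetand on the right is \<open>One\<close>.\<close>

lemma S_le_q:
  assumes s: "s \<in> skew_carrier B" and t: "t \<in> skew_carrier B"
  shows "\<bbbone>\<^bsub>S\<^esub> \<otimes>\<^bsub>S\<^esub> s \<otimes>\<^bsub>S\<^esub> t \<otimes>\<^bsub>S\<^esub> q_term S s \<otimes>\<^bsub>S\<^esub> q_term S t
      \<preceq>\<^bsub>S\<^esub> q_term S (s \<otimes>\<^bsub>S\<^esub> t) \<curlywedge>\<^bsub>S\<^esub> q_term S (s \<curlyvee>\<^bsub>S\<^esub> t) \<curlywedge>\<^bsub>S\<^esub>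
        q_term S (s \<leadsto>\<^bsub>S\<^esub> t) \<curlywedge>\<^bsub>S\<^esub> (\<bbbone>\<^bsub>S\<^esub> \<otimes>\<^bsub>S\<^esub> (s \<leadsto>\<^bsub>S\<^esub> t))" (is "?l \<preceq>\<^bsub>S\<^esub> ?r")
proof -
  have q: "q_term S u \<in> skew_carrier B" for u
    by (cases u) (simp_all add: S_q_term)
  have r: "?r \<in> skew_carrier B"
    using s t by (intro S_meet_closed q) (simp add: S_f_sq irl_imp_def S_simps skew_mult_closed skew_neg_closed)
  consider b c where "b \<in> carrier B" "c \<in> carrier B" "s = Base b" "t = Base c" | "?l = Zero"
    using s t by (auto elim!: skew_carrier_cases simp: S_f_sq S_q_term S_simps)
  then show ?thesis
  proof cases
    case 1
    then obtain d where d: "d \<in> carrier B" "s \<curlyvee>\<^bsub>S\<^esub> t = Base d" using base_join_base by blast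
    have "One \<curlywedge>\<^bsub>S\<^esub> One = One"
      using leq_refl[of One] S_le_iff[of One One] by (simp add: lle_def)
    then have "?r = One"
      using 1 d by (simp add: S_q_term S_f_sq irl_imp_def S_simps(2,3,6))
    moreover have "?l \<in> skew_carrier B"
      using s t q by (simp add: S_f_sq S_simps(2) skew_mult_closed)
    ultimately show ?thesis by (simp add: S_le_iff leq_one)
  next
    case 2
    then show ?thesis using r by (simp add: S_le_iff zero_leq)
  qed
qed

end

text \<open>A jointly injective family of homomorphisms reflects equations, and also inequalities,
  which are equations between meets. The identities are thus checked in each skew
  reflection.\<close>

lemma variety_U_of_separating_homs:
  fixes A :: "'a irl" (structure) and B :: "'i \<Rightarrow> 'b rl"
  assumes "de_morgan_monoid A"
    and hom: "\<And>i. i \<in> I \<Longrightarrow> h i \<in> irl_hom A (skew_reflection (B i) (leq i))"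
    and skew: "\<And>i. i \<in> I \<Longrightarrow> zero_irreducible_skew_reflection (B i) (leq i)"
    and separating:
      "\<And>x y. \<lbrakk>x \<in> carrier A; y \<in> carrier A; \<And>i. i \<in> I \<Longrightarrow> h i x = h i y\<rbrakk> \<Longrightarrow> x = y"
  shows "variety_U A"
proof -
  interpret de_morgan_monoid A by fact
  have hom': "irl_homomorphism A (skew_reflection (B i) (leq i)) (h i)" if "i \<in> I" for i
    using hom[OF that] by unfold_locales
  have leI: "x \<preceq> y"
    if "x \<in> carrier A" "y \<in> carrier A"
      "\<And>i. i \<in> I \<Longrightarrow> h i x \<preceq>\<^bsub>skew_reflection (B i) (leq i)\<^esub> h i y" for x y
    unfolding lle_def
    using that by (intro separating) (auto simp: closed irl_homomorphism.hom_meet[OF hom'] lle_def)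
  show ?thesis
  proof (unfold_locales, goal_cases)
    case (1 x)
    show ?case
    proof (rule separating)
      fix i assume i: "i \<in> I"
      interpret irl_homomorphism A "skew_reflection (B i) (leq i)" "h i" using hom' i .
      interpret zero_irreducible_skew_reflection "B i" "leq i" using skew i .
      show "h i (x \<otimes> x \<curlyvee> \<sim> x \<otimes> \<sim> x) = h i \<bbbone>"
        using S_square[of "h i x"] hom_closed[of x] 1 by (simp add: hom_simps(2-) closed S_simps(1))
    qed (use 1 in \<open>simp_all add: closed\<close>)
  next
    case (2 x y)
    show ?case
    proof (rule leI)
      fix i assume i: "i \<in> I"
      interpret irl_homomorphism A "skew_reflection (B i) (leq i)" "h i" using hom' i .
      interpret zero_irreducible_skew_reflection "B i" "leq i" using skew i .
      show "h i (\<bbbone> \<leadsto> (x \<curlyvee> y)) \<preceq>\<^bsub>S\<^esub> h i ((\<bbbone> \<leadsto> x) \<curlyvee> (\<bbbone> \<leadsto> y))"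
        using S_one_imp_join[of "h i x" "h i y"] hom_closed[of x] hom_closed[of y] 2
        by (simp add: hom_simps(2-) closed S_simps(1))
    qed (use 2 in \<open>simp_all add: closed\<close>)
  next
    case (3 x y)
    show ?case
    proof (rule leI)
      fix i assume i: "i \<in> I"
      interpret irl_homomorphism A "skew_reflection (B i) (leq i)" "h i" using hom' i .
      interpret zero_irreducible_skew_reflection "B i" "leq i" using skew i .
      show "h i (\<bbbone> \<otimes> x \<otimes> y \<otimes> q_term A x \<otimes> q_term A y) \<preceq>\<^bsub>S\<^esub>
          h i (q_term A (x \<otimes> y) \<curlywedge> q_term A (x \<curlyvee> y) \<curlywedge> q_term A (x \<leadsto> y) \<curlywedge> (\<bbbone> \<otimes> (x \<leadsto> y)))"
        using S_le_q[of "h i x" "h i y"] hom_closed[of x] hom_closed[of y] 3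
        by (simp add: hom_simps(2-) closed S_simps(1))
    qed (use 3 in \<open>simp_all add: closed\<close>)
  qed
qed

section \<open>Subdirect representations\<close>

lemma irl_prod_simps:
  "carrier (irl_prod I F) = (\<Pi>\<^sub>E i\<in>I. carrier (F i))"
  "\<one>\<^bsub>irl_prod I F\<^esub> = (\<lambda>i\<in>I. \<one>\<^bsub>F i\<^esub>)"
  "\<sim>\<^bsub>irl_prod I F\<^esub> x = (\<lambda>i\<in>I. \<sim>\<^bsub>F i\<^esub> (x i))"
  "x \<otimes>\<^bsub>irl_prod I F\<^esub> y = (\<lambda>i\<in>I. x i \<otimes>\<^bsub>F i\<^esub> y i)"
  "x \<curlywedge>\<^bsub>irl_prod I F\<^esub> y = (\<lambda>i\<in>I. x i \<curlywedge>\<^bsub>F i\<^esub> y i)"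
  "x \<curlyvee>\<^bsub>irl_prod I F\<^esub> y = (\<lambda>i\<in>I. x i \<curlyvee>\<^bsub>F i\<^esub> y i)"
  by (simp_all add: irl_prod_def)

text \<open>The coordinates of the isomorphism are homomorphisms to the factors. They separate
  points because members of the product are extensional functions on \<open>I\<close>.\<close>

lemma variety_U_of_representation:
  fixes A :: "'a irl" and B :: "'i \<Rightarrow> 'b rl"
  assumes A: "de_morgan_monoid A" and rep: "skew_subdirect_representation A I B F"
  shows "variety_U A"
proof -
  obtain X g where X: "X \<subseteq> carrier (irl_prod I F)"
    and g: "g \<in> irl_iso A ((irl_prod I F)\<lparr>carrier := X\<rparr>)"
    using rep by (auto simp: skew_subdirect_representation_def subdirect_product_def irl_subuniverse_def)
  have g_mem: "g x \<in> carrier (irl_prod I F)" if "x \<in> carrier A" for x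
    using g X that by (auto simp: irl_iso_def bij_betw_def)
  have "\<exists>leq. skew_order (B i) leq \<and> F i = skew_reflection (B i) leq" if "i \<in> I" for i
    using rep that by (auto simp: skew_subdirect_representation_def is_skew_reflection_def)
  then obtain leq where leq: "\<And>i. i \<in> I \<Longrightarrow> skew_order (B i) (leq i)"
      "\<And>i. i \<in> I \<Longrightarrow> F i = skew_reflection (B i) (leq i)"
    by metis
  show ?thesis
  proof (rule variety_U_of_separating_homs[OF A])
    fix i assume i: "i \<in> I"
    have "g x i \<in> carrier (F i)" if "x \<in> carrier A" for x
      using g_mem[OF that] i by (auto simp: irl_prod_simps)
    then have "(\<lambda>x. g x i) \<in> irl_hom A (F i)"
      using g i by (auto simp: irl_iso_def irl_hom_def irl_prod_simps)
    then show "(\<lambda>x. g x i) \<in> irl_hom A (skew_reflection (B i) (leq i))"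
      using leq(2) i by simp
    show "zero_irreducible_skew_reflection (B i) (leq i)"
      using rep leq[OF i] i
      by (auto simp: skew_subdirect_representation_def zero_irreducible_skew_reflection_def
          zero_irreducible_skew_reflection_axioms_def dunn_monoid_def)
  next
    fix x y assume xy: "x \<in> carrier A" "y \<in> carrier A" "\<And>i. i \<in> I \<Longrightarrow> g x i = g y i"
    then have "g x = g y"
      using g_mem[OF xy(1)] g_mem[OF xy(2)] by (auto simp: irl_prod_simps intro: PiE_ext)
    then show "x = y" using g xy by (auto simp: irl_iso_def bij_betw_def inj_on_def)
  qed
qed

text \<open>The prime filter is chosen to avoid \<open>x \<leadsto> y\<close>, which is not above
  \<open>\<one>\<close>. The quotient map followed by \<open>to_skew\<close> then distinguishes
  \<open>x\<close> from \<open>y\<close>.\<close>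

lemma separating_skew_reflection:
  fixes A :: "'a irl" (structure)
  assumes U: "variety_U A" and xy: "x \<in> carrier A" "y \<in> carrier A" "\<not> x \<preceq> y"
  shows "\<exists>(B :: 'a rl) F h. dunn_monoid B \<and> is_skew_reflection B F \<and> meet_irreducible F Zero \<and>
    h \<in> irl_hom A F \<and> h ` carrier A = carrier F \<and> h x \<noteq> h y"
proof -
  interpret variety_U A by fact
  have dm: "de_morgan_monoid A" by unfold_locales
  obtain D where "prime_filter A D" and D: "x \<leadsto> y \<notin> D"
    using prime_filter_exists[OF dm, of "x \<leadsto> y"] xy le_iff_one_le_imp[OF xy(1,2)] by (auto simp: closed)
  interpret prime_filter A D by fact
  interpret Q: variety_U Q
    using variety_U_image[OF U r_hom _ quotient_de_morgan] by (simp add: quotient_carrier)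
  have "r (x \<leadsto> y) \<in> carrier Q" "\<not> \<one>\<^bsub>Q\<^esub> \<preceq>\<^bsub>Q\<^esub> r (x \<leadsto> y)"
    using xy D by (simp_all add: one_le_quotient_iff quotient_carrier closed)
  \<comment> \<open>The class of \<open>x \<leadsto> y\<close> is the element required by
    \<open>not_one_le\<close>.\<close>
  then interpret Q: join_prime_U Q
    by unfold_locales (rule quotient_one_join_prime, assumption+, rule bexI)
  have "Q.to_skew \<circ> r \<in> irl_hom A Q.SR"
    using r_hom Q.to_skew_hom by (rule irl_hom_compose)
  moreover have "(Q.to_skew \<circ> r) ` carrier A = carrier Q.SR"
    using Q.skew_reflection_representation(5) by (simp add: bij_betw_def quotient_carrier flip: image_image)
  moreover have "r x \<noteq> r y"
    using xy D by (simp add: r_eq_iff)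
  then have "(Q.to_skew \<circ> r) x \<noteq> (Q.to_skew \<circ> r) y"
    using Q.skew_reflection_representation(5) xy
    by (auto simp: bij_betw_def inj_on_def quotient_carrier)
  ultimately show ?thesis
    using Q.skew_reflection_representation(1-3) by (intro exI conjI)
qed

lemma representation_of_variety_U:
  fixes A :: "'a irl" (structure)
  assumes U: "variety_U A"
  shows "\<exists>(I :: ('a \<times> 'a) set) (B :: 'a \<times> 'a \<Rightarrow> 'a rl) F. skew_subdirect_representation A I B F"
proof -
  interpret variety_U A by fact
  \<comment> \<open>Each failure of the order contributes one factor; the trivial algebra gets the
    empty family.\<close>
  define I where "I = {(x, y). x \<in> carrier A \<and> y \<in> carrier A \<and> \<not> x \<preceq> y}"
  have "\<exists>(B :: 'a rl) F h. dunn_monoid B \<and> is_skew_reflection B F \<and> meet_irreducible F Zero \<and>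
      h \<in> irl_hom A F \<and> h ` carrier A = carrier F \<and> h (fst i) \<noteq> h (snd i)" if "i \<in> I" for i
    using separating_skew_reflection[OF U] that by (auto simp: I_def)
  then obtain B :: "'a \<times> 'a \<Rightarrow> 'a rl" and F h where
    BF: "\<And>i. i \<in> I \<Longrightarrow> dunn_monoid (B i) \<and> is_skew_reflection (B i) (F i) \<and> meet_irreducible (F i) Zero"
    and hom: "\<And>i. i \<in> I \<Longrightarrow> h i \<in> irl_hom A (F i)"
    and surj: "\<And>i. i \<in> I \<Longrightarrow> h i ` carrier A = carrier (F i)"
    and sep: "\<And>i. i \<in> I \<Longrightarrow> h i (fst i) \<noteq> h i (snd i)"
    by metis
  \<comment> \<open>The restriction to \<open>I\<close> makes the values extensional, as membership
    in \<open>irl_prod\<close> demands.\<close>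
  define g where "g x = (\<lambda>i\<in>I. h i x)" for x
  let ?X = "g ` carrier A"
  let ?P = "(irl_prod I F)\<lparr>carrier := ?X\<rparr>"
  have ops: "g \<one> = \<one>\<^bsub>irl_prod I F\<^esub>"
    "\<And>x. x \<in> carrier A \<Longrightarrow> g (\<sim> x) = \<sim>\<^bsub>irl_prod I F\<^esub> (g x)"
    "\<And>x y. \<lbrakk>x \<in> carrier A; y \<in> carrier A\<rbrakk> \<Longrightarrow> g (x \<otimes> y) = g x \<otimes>\<^bsub>irl_prod I F\<^esub> g y"
    "\<And>x y. \<lbrakk>x \<in> carrier A; y \<in> carrier A\<rbrakk> \<Longrightarrow> g (x \<curlywedge> y) = g x \<curlywedge>\<^bsub>irl_prod I F\<^esub> g y"
    "\<And>x y. \<lbrakk>x \<in> carrier A; y \<in> carrier A\<rbrakk> \<Longrightarrow> g (x \<curlyvee> y) = g x \<curlyvee>\<^bsub>irl_prod I F\<^esub> g y"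
    using hom by (auto simp: g_def irl_prod_simps irl_hom_def intro!: restrict_ext)
  have "inj_on g (carrier A)"
  proof (rule inj_onI)
    fix x y assume xy: "x \<in> carrier A" "y \<in> carrier A" "g x = g y"
    \<comment> \<open>Otherwise \<open>(x, y)\<close> would be an index whose coordinate separates
      \<open>x\<close> and \<open>y\<close>. By symmetry and antisymmetry, \<open>g\<close> is
      injective.\<close>
    have "x \<preceq> y" if xy: "x \<in> carrier A" "y \<in> carrier A" "g x = g y" for x y
      using sep[of "(x, y)"] fun_cong[OF xy(3), of "(x, y)"] xy(1,2)
      by (cases "x \<preceq> y") (auto simp: I_def g_def)
    then show "x = y" using xy le_antisym by metis
  qed
  then have "g \<in> irl_iso A ?P"
    by (simp add: irl_iso_def ops inj_on_imp_bij_betw)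
  moreover have "irl_subuniverse ?X (irl_prod I F)"
    unfolding irl_subuniverse_def
  proof (intro conjI)
    show "?X \<subseteq> carrier (irl_prod I F)"
      using surj by (fastforce simp: g_def irl_prod_simps)
    show "\<one>\<^bsub>irl_prod I F\<^esub> \<in> ?X"
      unfolding ops(1)[symmetric] by simp
  qed (auto simp: closed simp flip: ops)
  moreover have "(\<lambda>x. x i) ` ?X = carrier (F i)" if "i \<in> I" for i
    using surj[OF that] that by (simp add: g_def image_image)
  ultimately have "skew_subdirect_representation A I B F"
    unfolding skew_subdirect_representation_def subdirect_product_def using BF by blast
  then show ?thesis by blast
qed

text \<open>The second conjunct leaves the index and element types free, so it also covers
  representations over types other than \<open>'a \<times> 'a\<close> and \<open>'a\<close>, where
  the construction for the first conjunct takes place.\<close>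

theorem corollary5p6:
  fixes A :: "'a irl"
  assumes "de_morgan_monoid A"
  shows "(variety_U A \<longleftrightarrow>
           (\<exists>(I :: ('a \<times> 'a) set) (B :: 'a \<times> 'a \<Rightarrow> 'a rl) F. skew_subdirect_representation A I B F))
       \<and> (\<forall>(I :: 'i set) (B :: 'i \<Rightarrow> 'b rl) F.
             skew_subdirect_representation A I B F \<longrightarrow> variety_U A)"
  by (intro conjI iffI allI impI; (elim exE)?)
    (erule representation_of_variety_U variety_U_of_representation[OF assms])+

end
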